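(* Let $\mathcal{C}$ be a weakly self-dual (finite-dimensional, symmetric) monoidal category of convex operational models. Then $\mathcal{C}$ is dagger compact with respect to the canonical adjoint $' : \mathcal{C}^{op}\to\mathcal{C}$ (for some choice of the pairs $(\gamma_A,f_A)$ implementing weak self-duality) if and only if $\mathcal{C}$ is symmetrically self-dual.
   Context: All vector spaces are finite-dimensional and real; $V^*$ is the dual space. A cone is regular if it is closed, convex, pointed and generating. A linear map between ordered vector spaces is positive if it maps the positive cone into the positive cone. A convex operational model (COM) is a triple $(A, A^{\#}, u_A)$, abbreviated $A$, where $A$ is an ordered vector space with regular cone $A_+$, $u_A \in A^*$ is strictly positive on $A_+\setminus\{0\}$, and $A^{\#}$ is the vector space $A^*$ ordered by a chosen regular cone $A^{\#}_+ \subseteq A^*_+ = \{a \in A^* : a(\alpha)\ge 0\ \forall \alpha\in A_+\}$ with $u_A \in A^{\#}_+$. A morphism of COMs $A \to B$ is a positive linear map $\phi: A\to B$ with $\phi^*(B^{\#}_+)\subseteq A^{\#}_+$. These form a category $\mathbf{Com}$. Let $I = (\mathbb{R},\mathbb{R},1)$ with the standard cones. A category of COMs is a subcategory $\mathcal{C}$ of $\mathbf{Com}$ such that each $\mathcal{C}(A,B)$ is a regular sub-cone of the cone of COM morphisms $A \to B$, $I \in \mathcal{C}$, $\mathcal{C}(I,A)\simeq A$ (every $\alpha \in A_+$ is identified with the morphism $t\mapsto t\alpha$, so $\mathcal{C}(I,A)=A_+$), and $\mathcal{C}(A,I)\simeq A^{\#}$ (so $\mathcal{C}(A,I) = A^{\#}_+$).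 A composite of COMs $A,B$ is a COM $(AB,(AB)^{\#},u_{AB})$ with $AB$ contained in the space of bilinear forms on $A^{\#}\times B^{\#}$ (hence, as a vector space, $A\otimes B$), $u_{AB} = u_A\otimes u_B$, $\alpha\otimes\beta \in (AB)_+$ for all $\alpha\in A_+,\beta\in B_+$ (where $(\alpha\otimes\beta)(a,b)=a(\alpha)b(\beta)$), and $a\otimes b\in (AB)^{\#}_+$ for all $a\in A^{\#}_+, b\in B^{\#}_+$. A monoidal category of COMs is a category of COMs with a symmetric monoidal structure whose unit is $I$ and in which each $A\otimes B$ is a composite of $A$ and $B$ in this sense. The tensor product of morphisms, the associativity and unit isomorphisms (treated as identities) and the symmetries $\sigma_{A,B}$ are those of the usual tensor product of vector spaces. For $\gamma\in (A\otimes B)_+=\mathcal{C}(I,A\otimes B)$ define $\hat\gamma: A^{\#}\to B$ by $\hat\gamma(a) = (a\otimes 1_B)\circ\gamma$; for $f\in (A\otimes B)^{\#}_+=\mathcal{C}(A\otimes B,I)$ define $\hat f: A\to B^{\#}$ by $\hat f(\alpha) (\beta)=f(\alpha\otimes\beta)$. $\mathcal{C}$ is weakly self-dual if for every $A\in\mathcal{C}$ there is a pair $(\gamma_A,f_A)$ with $\gamma_A \in (A\otimes A)_+$ (a possibly un-normalized bipartite state) and $f_A \in (A\otimes A)^{\#}_+$ such that $\hat\gamma_A: A^{\#}\to A$ is an order-isomorphism and $\hat f_A = \hat\gamma_A^{-1}$. It is symmetrically self-dual if moreover $\gamma_A$ can be chosen symmetric ($\sigma_{A,A}\circ\gamma_A=\gamma_A$)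 for every $A\in\mathcal{C}$. A dual for $A$ is a triple $(A',\eta_A,\epsilon_A)$ with $\eta_A: I\to A'\otimes A$, $\epsilon_A: A\otimes A'\to I$ such that $(\epsilon_A\otimes 1_A)\circ(1_A\otimes\eta_A)=1_A$ and $(1_{A'}\otimes\epsilon_A)\circ(\eta_A\otimes 1_{A'})=1_{A'}$; $\mathcal{C}$ is compact closed if every object has a dual. A weakly self-dual $\mathcal{C}$ is regarded as compact closed with the compact structure $A'=A$, $\eta_A=\gamma_A$, $\epsilon_A=f_A$. Standing convention: whenever a family $(\gamma_A,f_A)_{A}$ is chosen (including a symmetric one), it is chosen compatibly with tensor products (it is assumed that this is possible), i.e. $\gamma_I=f_I=1_I$, $\gamma_{A\otimes B} = (1_A\otimes\sigma_{A,B}\otimes 1_B)\circ(\gamma_A\otimes\gamma_B)$ and $f_{A\otimes B}=(f_A\otimes f_B)\circ(1_A\otimes\sigma_{B,A}\otimes 1_B)$. The canonical adjoint of $\phi\in\mathcal{C}(A,B)$ is $\phi'=(1_{A}\otimes f_B)\circ(1_{A}\otimes\phi\otimes 1_{B})\circ(\gamma_A\otimes 1_{B})\in\mathcal{C}(B,A)$. A dagger on $\mathcal{C}$ is a functor $(-)^\dagger:\mathcal{C}^{op}\to\mathcal{C}$ that is the identity on objects with $\phi^{\dagger\dagger}=\phi$. A morphism $\phi$ is unitary if $\phi^\dagger=\phi^{-1}$. A dagger-monoidal category is a symmetric monoidal category with a dagger such that the canonical isomorphisms of the symmetric monoidal structure are unitary and $(\phi\otimes\psi)^\dagger=\phi^\dagger\otimes\psi^\dagger$.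 It is dagger compact if it is compact closed and $\eta_A=\sigma_{A,A'}\circ\epsilon_A^\dagger$ for every $A$. "Dagger compact with respect to the canonical adjoint" means that $\dagger = {}'$ satisfies these conditions with $\eta_A=\gamma_A$, $\epsilon_A=f_A$. *)

theory Defs
  imports "HOL-Analysis.Analysis" "HOL-Library.Function_Algebras"
begin

section \<open>Linear maps between subspaces, and regular cones\<close>

text \<open>
  Finite-dimensional vector spaces are subspaces of one real normed vector space \<open>'v\<close> (an arbitrary
  type, so of arbitrary dimension).  On finite-dimensional subspaces all the topologies below are
  the canonical ones.  A linear map on a subspace \<open>E\<close> is represented by the function that is extended
  by \<open>0\<close> outside \<open>E\<close>: this makes equality of maps extensional, makes the maps on \<open>E\<close> a vector space
  for the pointwise operations, and makes composition the plain composition of functions.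
\<close>

instantiation "fun" :: (type, real_vector) real_vector
begin

definition scaleR_fun :: "real \<Rightarrow> ('a \<Rightarrow> 'b) \<Rightarrow> 'a \<Rightarrow> 'b" where
  "scaleR_fun c f = (\<lambda>x. c *\<^sub>R f x)"

instance
  by standard (auto simp: scaleR_fun_def fun_eq_iff scaleR_add_right scaleR_add_left)

end

definition linear_between :: "'a::real_vector set \<Rightarrow> 'b::real_vector set \<Rightarrow> ('a \<Rightarrow> 'b) \<Rightarrow> bool" where
  "linear_between E F h \<longleftrightarrow>
     (\<forall>x\<in>E. h x \<in> F) \<and>
     (\<forall>x\<in>E. \<forall>y\<in>E. h (x + y) = h x + h y) \<and>
     (\<forall>c. \<forall>x\<in>E. h (c *\<^sub>R x) = c *\<^sub>R h x)"

definition lin_maps :: "'a::real_vector set \<Rightarrow> 'b::real_vector set \<Rightarrow> ('a \<Rightarrow> 'b) set" where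
  "lin_maps E F = {h. linear_between E F h \<and> (\<forall>x. x \<notin> E \<longrightarrow> h x = 0)}"

definition dual_space :: "'a::real_vector set \<Rightarrow> ('a \<Rightarrow> real) set" where
  "dual_space E = lin_maps E UNIV"

definition bilinear_forms ::
    "'a::real_vector set \<Rightarrow> 'b::real_vector set \<Rightarrow> ('a \<Rightarrow> 'b \<Rightarrow> real) set" where
  "bilinear_forms E F =
     {w. (\<forall>a. (\<lambda>b. w a b) \<in> dual_space F) \<and> (\<forall>b. (\<lambda>a. w a b) \<in> dual_space E)}"

definition id_map :: "'a::real_vector set \<Rightarrow> 'a \<Rightarrow> 'a" where
  "id_map E = (\<lambda>x. if x \<in> E then x else 0)"

definition inv_map ::
    "'a::real_vector set \<Rightarrow> 'b::real_vector set \<Rightarrow> ('a \<Rightarrow> 'b) \<Rightarrow> 'b \<Rightarrow> 'a" where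
  "inv_map E F h = (\<lambda>y. if y \<in> F then inv_into E h y else 0)"

definition regular_cone :: "'a::{real_vector, topological_space} set \<Rightarrow> 'a set \<Rightarrow> bool" where
  "regular_cone E K \<longleftrightarrow>
     closed K \<and> convex_cone K \<and> K \<inter> uminus ` K = {0} \<and> E = {x - y | x y. x \<in> K \<and> y \<in> K}"

definition order_isomorphism ::
    "'a::real_vector set \<Rightarrow> 'a set \<Rightarrow> 'b::real_vector set \<Rightarrow> 'b set \<Rightarrow> ('a \<Rightarrow> 'b) \<Rightarrow> bool" where
  "order_isomorphism E P F Q h \<longleftrightarrow> linear_between E F h \<and> bij_betw h E F \<and> h ` P = Q"


section \<open>Convex operational models\<close>

text \<open>The fields are \<open>A\<close>, \<open>A\<^sub>+\<close>, the cone of the ordered space \<open>A\<^sup>#\<close>, and \<open>u\<^sub>A\<close>.\<close>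

record 'v com =
  com_space :: "'v set"
  com_pos :: "'v set"
  com_eff :: "('v \<Rightarrow> real) set"
  com_unit :: "'v \<Rightarrow> real"

abbreviation com_dual :: "'v::real_normed_vector com \<Rightarrow> ('v \<Rightarrow> real) set" where
  "com_dual A \<equiv> dual_space (com_space A)"

definition is_com :: "'v::real_normed_vector com \<Rightarrow> bool" where
  "is_com A \<longleftrightarrow>
     (\<exists>B. finite B \<and> com_space A = span B) \<and>
     regular_cone (com_space A) (com_pos A) \<and>
     com_unit A \<in> com_dual A \<and>
     (\<forall>\<alpha> \<in> com_pos A - {0}. com_unit A \<alpha> > 0) \<and>
     com_eff A \<subseteq> {a \<in> com_dual A. \<forall>\<alpha>\<in>com_pos A. a \<alpha> \<ge> 0} \<and>
     regular_cone (com_dual A) (com_eff A) \<and>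
     com_unit A \<in> com_eff A"

definition lin :: "'v::real_normed_vector com \<Rightarrow> 'v com \<Rightarrow> ('v \<Rightarrow> 'v) set" where
  "lin A B = lin_maps (com_space A) (com_space B)"

definition idm :: "'v::real_normed_vector com \<Rightarrow> 'v \<Rightarrow> 'v" where
  "idm A = id_map (com_space A)"

definition invm :: "'v::real_normed_vector com \<Rightarrow> 'v com \<Rightarrow> ('v \<Rightarrow> 'v) \<Rightarrow> 'v \<Rightarrow> 'v" where
  "invm A B \<phi> = inv_map (com_space A) (com_space B) \<phi>"

definition com_morphisms :: "'v::real_normed_vector com \<Rightarrow> 'v com \<Rightarrow> ('v \<Rightarrow> 'v) set" where
  "com_morphisms A B =
     {\<phi> \<in> lin A B. (\<forall>\<alpha>\<in>com_pos A. \<phi> \<alpha> \<in> com_pos B) \<and> (\<forall>b\<in>com_eff B. b \<circ> \<phi> \<in> com_eff A)}"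

text \<open>The COM \<open>(\<real>, \<real>, 1)\<close>, where \<open>\<real>\<close> is realised as the line through \<open>e \<noteq> 0\<close>, with \<open>e\<close> as the
  number 1; \<open>line_coord e\<close> sends \<open>t *\<^sub>R e\<close> to \<open>t\<close>.\<close>

definition line_coord :: "'v::real_normed_vector \<Rightarrow> 'v \<Rightarrow> real" where
  "line_coord e = (\<lambda>x. if x \<in> span {e} then (THE t. x = t *\<^sub>R e) else 0)"

definition line_com :: "'v::real_normed_vector \<Rightarrow> 'v com" where
  "line_com e =
     \<lparr>com_space = span {e},
      com_pos = {t *\<^sub>R e | t. t \<ge> 0},
      com_eff = {t *\<^sub>R line_coord e | t. t \<ge> 0},
      com_unit = line_coord e\<rparr>"


section \<open>Categories of convex operational models\<close>

text \<open>
  The data of a (monoidal) category of COMs: objects, morphisms, the vector that plays the role of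
  \<open>1 \<in> \<real> = I\<close>, the composite of two COMs, and the map that exhibits a vector of the composite of
  \<open>A\<close> and \<open>B\<close> as a bilinear form on \<open>A\<^sup># \<times> B\<^sup>#\<close>.
\<close>

record 'v com_category =
  Obj :: "'v com set"
  Hom :: "'v com \<Rightarrow> 'v com \<Rightarrow> ('v \<Rightarrow> 'v) set"
  one_vec :: 'v
  tensor :: "'v com \<Rightarrow> 'v com \<Rightarrow> 'v com" (infixl \<open>\<otimes>\<index>\<close> 70)
  form :: "'v com \<Rightarrow> 'v com \<Rightarrow> 'v \<Rightarrow> ('v \<Rightarrow> real) \<Rightarrow> ('v \<Rightarrow> real) \<Rightarrow> real"

definition I_ob :: "'v::real_normed_vector com_category \<Rightarrow> 'v com" (\<open>\<I>\<index>\<close>) where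
  "\<I>\<^bsub>C\<^esub> = line_com (one_vec C)"

text \<open>The identifications of \<open>\<alpha> \<in> A\<close> with the map \<open>t \<mapsto> t \<alpha>\<close>, \<open>I \<rightarrow> A\<close>, and of a functional on \<open>A\<close>
  with a map \<open>A \<rightarrow> I\<close>.\<close>

definition state_map :: "'v::real_normed_vector com_category \<Rightarrow> 'v \<Rightarrow> 'v \<Rightarrow> 'v" where
  "state_map C \<alpha> = (\<lambda>x. com_unit \<I>\<^bsub>C\<^esub> x *\<^sub>R \<alpha>)"

definition effect_map :: "'v::real_normed_vector com_category \<Rightarrow> ('v \<Rightarrow> real) \<Rightarrow> 'v \<Rightarrow> 'v" where
  "effect_map C a = (\<lambda>x. a x *\<^sub>R one_vec C)"

definition category_of_coms :: "'v::real_normed_vector com_category \<Rightarrow> bool" where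
  "category_of_coms C \<longleftrightarrow>
     one_vec C \<noteq> 0 \<and>
     (\<forall>A\<in>Obj C. is_com A) \<and>
     (\<forall>A\<in>Obj C. \<forall>B\<in>Obj C. Hom C A B \<subseteq> com_morphisms A B \<and> regular_cone (lin A B) (Hom C A B)) \<and>
     (\<forall>A\<in>Obj C. idm A \<in> Hom C A A) \<and>
     (\<forall>A\<in>Obj C. \<forall>B\<in>Obj C. \<forall>D\<in>Obj C. \<forall>\<phi>\<in>Hom C A B. \<forall>\<psi>\<in>Hom C B D. \<psi> \<circ> \<phi> \<in> Hom C A D) \<and>
     \<I>\<^bsub>C\<^esub> \<in> Obj C \<and>
     (\<forall>A\<in>Obj C. Hom C \<I>\<^bsub>C\<^esub> A = state_map C ` com_pos A) \<and>
     (\<forall>A\<in>Obj C. Hom C A \<I>\<^bsub>C\<^esub> = effect_map C ` com_eff A)"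


section \<open>Composites and monoidal categories of convex operational models\<close>

definition product_form ::
    "'v::real_normed_vector com \<Rightarrow> 'v com \<Rightarrow> 'v \<Rightarrow> 'v \<Rightarrow> ('v \<Rightarrow> real) \<Rightarrow> ('v \<Rightarrow> real) \<Rightarrow> real" where
  "product_form A B \<alpha> \<beta> = (\<lambda>a b. if a \<in> com_dual A \<and> b \<in> com_dual B then a \<alpha> * b \<beta> else 0)"

text \<open>
  \<open>is_composite A B AB F\<close>: the COM \<open>AB\<close>, contained by means of \<open>F\<close> in the bilinear forms, is a composite
  of \<open>A\<close> and \<open>B\<close>.  The functional \<open>a \<otimes> b\<close> on \<open>AB\<close> is evaluation of bilinear forms at \<open>(a, b)\<close>.
\<close>

definition is_composite ::
    "'v::real_normed_vector com \<Rightarrow> 'v com \<Rightarrow> 'v com \<Rightarrow>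
     ('v \<Rightarrow> ('v \<Rightarrow> real) \<Rightarrow> ('v \<Rightarrow> real) \<Rightarrow> real) \<Rightarrow> bool" where
  "is_composite A B AB F \<longleftrightarrow>
     is_com AB \<and>
     F \<in> lin_maps (com_space AB) (bilinear_forms (com_dual A) (com_dual B)) \<and>
     inj_on F (com_space AB) \<and>
     com_unit AB = (\<lambda>\<omega>. F \<omega> (com_unit A) (com_unit B)) \<and>
     (\<forall>\<alpha>\<in>com_pos A. \<forall>\<beta>\<in>com_pos B. product_form A B \<alpha> \<beta> \<in> F ` com_pos AB) \<and>
     (\<forall>a\<in>com_eff A. \<forall>b\<in>com_eff B. (\<lambda>\<omega>. F \<omega> a b) \<in> com_eff AB)"

definition tvec ::
    "'v::real_normed_vector com_category \<Rightarrow> 'v com \<Rightarrow> 'v com \<Rightarrow> 'v \<Rightarrow> 'v \<Rightarrow> 'v" where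
  "tvec C A B \<alpha> \<beta> = inv_into (com_space (A \<otimes>\<^bsub>C\<^esub> B)) (form C A B) (product_form A B \<alpha> \<beta>)"

text \<open>\<open>tmap C A A' B B' \<phi> \<psi>\<close> is \<open>\<phi> \<otimes> \<psi>\<close> for \<open>\<phi> : A \<rightarrow> A'\<close> and \<open>\<psi> : B \<rightarrow> B'\<close>.\<close>

definition tmap ::
    "'v::real_normed_vector com_category \<Rightarrow> 'v com \<Rightarrow> 'v com \<Rightarrow> 'v com \<Rightarrow> 'v com \<Rightarrow>
     ('v \<Rightarrow> 'v) \<Rightarrow> ('v \<Rightarrow> 'v) \<Rightarrow> 'v \<Rightarrow> 'v" where
  "tmap C A A' B B' \<phi> \<psi> =
     (THE h. h \<in> lin (A \<otimes>\<^bsub>C\<^esub> B) (A' \<otimes>\<^bsub>C\<^esub> B') \<and>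
        (\<forall>\<alpha>\<in>com_space A. \<forall>\<beta>\<in>com_space B. h (tvec C A B \<alpha> \<beta>) = tvec C A' B' (\<phi> \<alpha>) (\<psi> \<beta>)))"

text \<open>The canonical isomorphisms \<open>(A \<otimes> B) \<otimes> D \<rightarrow> A \<otimes> (B \<otimes> D)\<close>, \<open>I \<otimes> A \<rightarrow> A\<close>, \<open>A \<otimes> I \<rightarrow> A\<close> and
  \<open>A \<otimes> B \<rightarrow> B \<otimes> A\<close> of vector spaces.\<close>

definition assoc ::
    "'v::real_normed_vector com_category \<Rightarrow> 'v com \<Rightarrow> 'v com \<Rightarrow> 'v com \<Rightarrow> 'v \<Rightarrow> 'v" where
  "assoc C A B D =
     (THE h. h \<in> lin ((A \<otimes>\<^bsub>C\<^esub> B) \<otimes>\<^bsub>C\<^esub> D) (A \<otimes>\<^bsub>C\<^esub> (B \<otimes>\<^bsub>C\<^esub> D)) \<and>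
        (\<forall>\<alpha>\<in>com_space A. \<forall>\<beta>\<in>com_space B. \<forall>\<delta>\<in>com_space D.
           h (tvec C (A \<otimes>\<^bsub>C\<^esub> B) D (tvec C A B \<alpha> \<beta>) \<delta>) =
           tvec C A (B \<otimes>\<^bsub>C\<^esub> D) \<alpha> (tvec C B D \<beta> \<delta>)))"

definition assoc_inv ::
    "'v::real_normed_vector com_category \<Rightarrow> 'v com \<Rightarrow> 'v com \<Rightarrow> 'v com \<Rightarrow> 'v \<Rightarrow> 'v" where
  "assoc_inv C A B D =
     invm ((A \<otimes>\<^bsub>C\<^esub> B) \<otimes>\<^bsub>C\<^esub> D) (A \<otimes>\<^bsub>C\<^esub> (B \<otimes>\<^bsub>C\<^esub> D)) (assoc C A B D)"

definition lunit :: "'v::real_normed_vector com_category \<Rightarrow> 'v com \<Rightarrow> 'v \<Rightarrow> 'v" where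
  "lunit C A =
     (THE h. h \<in> lin (\<I>\<^bsub>C\<^esub> \<otimes>\<^bsub>C\<^esub> A) A \<and> (\<forall>\<alpha>\<in>com_space A. h (tvec C \<I>\<^bsub>C\<^esub> A (one_vec C) \<alpha>) = \<alpha>))"

definition lunit_inv :: "'v::real_normed_vector com_category \<Rightarrow> 'v com \<Rightarrow> 'v \<Rightarrow> 'v" where
  "lunit_inv C A = invm (\<I>\<^bsub>C\<^esub> \<otimes>\<^bsub>C\<^esub> A) A (lunit C A)"

definition runit :: "'v::real_normed_vector com_category \<Rightarrow> 'v com \<Rightarrow> 'v \<Rightarrow> 'v" where
  "runit C A =
     (THE h. h \<in> lin (A \<otimes>\<^bsub>C\<^esub> \<I>\<^bsub>C\<^esub>) A \<and> (\<forall>\<alpha>\<in>com_space A. h (tvec C A \<I>\<^bsub>C\<^esub> \<alpha> (one_vec C)) = \<alpha>))"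

definition runit_inv :: "'v::real_normed_vector com_category \<Rightarrow> 'v com \<Rightarrow> 'v \<Rightarrow> 'v" where
  "runit_inv C A = invm (A \<otimes>\<^bsub>C\<^esub> \<I>\<^bsub>C\<^esub>) A (runit C A)"

definition swap :: "'v::real_normed_vector com_category \<Rightarrow> 'v com \<Rightarrow> 'v com \<Rightarrow> 'v \<Rightarrow> 'v" where
  "swap C A B =
     (THE h. h \<in> lin (A \<otimes>\<^bsub>C\<^esub> B) (B \<otimes>\<^bsub>C\<^esub> A) \<and>
        (\<forall>\<alpha>\<in>com_space A. \<forall>\<beta>\<in>com_space B. h (tvec C A B \<alpha> \<beta>) = tvec C B A \<beta> \<alpha>))"

text \<open>
  Functoriality of the tensor product, naturality of the canonical isomorphisms and the coherence
  equations hold automatically, because all these maps are the ones of vector spaces; what has to be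
  required is that they are morphisms of the category.
\<close>

definition monoidal_category_of_coms :: "'v::real_normed_vector com_category \<Rightarrow> bool" where
  "monoidal_category_of_coms C \<longleftrightarrow>
     category_of_coms C \<and>
     (\<forall>A\<in>Obj C. \<forall>B\<in>Obj C. A \<otimes>\<^bsub>C\<^esub> B \<in> Obj C \<and> is_composite A B (A \<otimes>\<^bsub>C\<^esub> B) (form C A B)) \<and>
     (\<forall>A\<in>Obj C. \<forall>A'\<in>Obj C. \<forall>B\<in>Obj C. \<forall>B'\<in>Obj C. \<forall>\<phi>\<in>Hom C A A'. \<forall>\<psi>\<in>Hom C B B'.
        tmap C A A' B B' \<phi> \<psi> \<in> Hom C (A \<otimes>\<^bsub>C\<^esub> B) (A' \<otimes>\<^bsub>C\<^esub> B')) \<and>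
     (\<forall>A\<in>Obj C. \<forall>B\<in>Obj C. \<forall>D\<in>Obj C.
        assoc C A B D \<in> Hom C ((A \<otimes>\<^bsub>C\<^esub> B) \<otimes>\<^bsub>C\<^esub> D) (A \<otimes>\<^bsub>C\<^esub> (B \<otimes>\<^bsub>C\<^esub> D)) \<and>
        assoc_inv C A B D \<in> Hom C (A \<otimes>\<^bsub>C\<^esub> (B \<otimes>\<^bsub>C\<^esub> D)) ((A \<otimes>\<^bsub>C\<^esub> B) \<otimes>\<^bsub>C\<^esub> D)) \<and>
     (\<forall>A\<in>Obj C.
        lunit C A \<in> Hom C (\<I>\<^bsub>C\<^esub> \<otimes>\<^bsub>C\<^esub> A) A \<and> lunit_inv C A \<in> Hom C A (\<I>\<^bsub>C\<^esub> \<otimes>\<^bsub>C\<^esub> A) \<and>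
        runit C A \<in> Hom C (A \<otimes>\<^bsub>C\<^esub> \<I>\<^bsub>C\<^esub>) A \<and> runit_inv C A \<in> Hom C A (A \<otimes>\<^bsub>C\<^esub> \<I>\<^bsub>C\<^esub>)) \<and>
     (\<forall>A\<in>Obj C. \<forall>B\<in>Obj C. swap C A B \<in> Hom C (A \<otimes>\<^bsub>C\<^esub> B) (B \<otimes>\<^bsub>C\<^esub> A))"


section \<open>Weak and symmetric self-duality\<close>

text \<open>For \<open>\<gamma> : I \<rightarrow> A \<otimes> B\<close> and \<open>f : A \<otimes> B \<rightarrow> I\<close>: the maps \<open>A\<^sup># \<rightarrow> B\<close> and \<open>A \<rightarrow> B\<^sup>#\<close> induced by them.
  A map into \<open>I\<close> is read as a functional through the coordinate \<open>com_unit I\<close>.\<close>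

definition state_hat ::
    "'v::real_normed_vector com_category \<Rightarrow> 'v com \<Rightarrow> 'v com \<Rightarrow> ('v \<Rightarrow> 'v) \<Rightarrow> ('v \<Rightarrow> real) \<Rightarrow> 'v" where
  "state_hat C A B \<gamma> a =
     (lunit C B \<circ> tmap C A \<I>\<^bsub>C\<^esub> B B (effect_map C a) (idm B) \<circ> \<gamma>) (one_vec C)"

definition effect_hat ::
    "'v::real_normed_vector com_category \<Rightarrow> 'v com \<Rightarrow> 'v com \<Rightarrow> ('v \<Rightarrow> 'v) \<Rightarrow> 'v \<Rightarrow> 'v \<Rightarrow> real" where
  "effect_hat C A B f \<alpha> =
     (\<lambda>\<beta>. if \<beta> \<in> com_space B then com_unit \<I>\<^bsub>C\<^esub> (f (tvec C A B \<alpha> \<beta>)) else 0)"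

definition implements_self_duality ::
    "'v::real_normed_vector com_category \<Rightarrow> 'v com \<Rightarrow> ('v \<Rightarrow> 'v) \<Rightarrow> ('v \<Rightarrow> 'v) \<Rightarrow> bool" where
  "implements_self_duality C A \<gamma> f \<longleftrightarrow>
     \<gamma> \<in> Hom C \<I>\<^bsub>C\<^esub> (A \<otimes>\<^bsub>C\<^esub> A) \<and>
     f \<in> Hom C (A \<otimes>\<^bsub>C\<^esub> A) \<I>\<^bsub>C\<^esub> \<and>
     order_isomorphism (com_dual A) (com_eff A) (com_space A) (com_pos A) (state_hat C A A \<gamma>) \<and>
     (\<forall>a\<in>com_dual A. effect_hat C A A f (state_hat C A A \<gamma> a) = a) \<and>
     (\<forall>\<alpha>\<in>com_space A. state_hat C A A \<gamma> (effect_hat C A A f \<alpha>) = \<alpha>)"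

definition weakly_self_dual :: "'v::real_normed_vector com_category \<Rightarrow> bool" where
  "weakly_self_dual C \<longleftrightarrow> (\<forall>A\<in>Obj C. \<exists>\<gamma> f. implements_self_duality C A \<gamma> f)"

definition symmetrically_self_dual :: "'v::real_normed_vector com_category \<Rightarrow> bool" where
  "symmetrically_self_dual C \<longleftrightarrow>
     (\<forall>A\<in>Obj C. \<exists>\<gamma> f. implements_self_duality C A \<gamma> f \<and> swap C A A \<circ> \<gamma> = \<gamma>)"

text \<open>\<open>1\<^sub>A \<otimes> \<sigma>\<^sub>B\<^sub>,\<^sub>D \<otimes> 1\<^sub>E : (A \<otimes> B) \<otimes> (D \<otimes> E) \<rightarrow> (A \<otimes> D) \<otimes> (B \<otimes> E)\<close> with the associativity isomorphisms
  written out.\<close>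

definition middle_swap ::
    "'v::real_normed_vector com_category \<Rightarrow> 'v com \<Rightarrow> 'v com \<Rightarrow> 'v com \<Rightarrow> 'v com \<Rightarrow> 'v \<Rightarrow> 'v" where
  "middle_swap C A B D E =
     assoc_inv C A D (B \<otimes>\<^bsub>C\<^esub> E) \<circ>
     tmap C A A (B \<otimes>\<^bsub>C\<^esub> (D \<otimes>\<^bsub>C\<^esub> E)) (D \<otimes>\<^bsub>C\<^esub> (B \<otimes>\<^bsub>C\<^esub> E)) (idm A)
       (assoc C D B E \<circ>
        tmap C (B \<otimes>\<^bsub>C\<^esub> D) (D \<otimes>\<^bsub>C\<^esub> B) E E (swap C B D) (idm E) \<circ>
        assoc_inv C B D E) \<circ>
     assoc C A B (D \<otimes>\<^bsub>C\<^esub> E)"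

definition self_duality_choice ::
    "'v::real_normed_vector com_category \<Rightarrow> ('v com \<Rightarrow> 'v \<Rightarrow> 'v) \<Rightarrow> ('v com \<Rightarrow> 'v \<Rightarrow> 'v) \<Rightarrow> bool" where
  "self_duality_choice C \<gamma> f \<longleftrightarrow>
     (\<forall>A\<in>Obj C. implements_self_duality C A (\<gamma> A) (f A)) \<and>
     \<gamma> \<I>\<^bsub>C\<^esub> = lunit_inv C \<I>\<^bsub>C\<^esub> \<and>
     f \<I>\<^bsub>C\<^esub> = lunit C \<I>\<^bsub>C\<^esub> \<and>
     (\<forall>A\<in>Obj C. \<forall>B\<in>Obj C.
        \<gamma> (A \<otimes>\<^bsub>C\<^esub> B) =
          middle_swap C A A B B \<circ>
          tmap C \<I>\<^bsub>C\<^esub> (A \<otimes>\<^bsub>C\<^esub> A) \<I>\<^bsub>C\<^esub> (B \<otimes>\<^bsub>C\<^esub> B) (\<gamma> A) (\<gamma> B) \<circ>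
          lunit_inv C \<I>\<^bsub>C\<^esub> \<and>
        f (A \<otimes>\<^bsub>C\<^esub> B) =
          lunit C \<I>\<^bsub>C\<^esub> \<circ>
          tmap C (A \<otimes>\<^bsub>C\<^esub> A) \<I>\<^bsub>C\<^esub> (B \<otimes>\<^bsub>C\<^esub> B) \<I>\<^bsub>C\<^esub> (f A) (f B) \<circ>
          middle_swap C A B A B)"

text \<open>The standing assumption that pairs implementing weak self-duality, and likewise symmetric such
  pairs, can be chosen compatibly with tensor products as soon as they exist.\<close>

definition compatible_choices_possible :: "'v::real_normed_vector com_category \<Rightarrow> bool" where
  "compatible_choices_possible C \<longleftrightarrow>
     (weakly_self_dual C \<longrightarrow> (\<exists>\<gamma> f. self_duality_choice C \<gamma> f)) \<and>
     (symmetrically_self_dual C \<longrightarrow>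
        (\<exists>\<gamma> f. self_duality_choice C \<gamma> f \<and> (\<forall>A\<in>Obj C. swap C A A \<circ> \<gamma> A = \<gamma> A)))"

text \<open>The canonical adjoint \<open>B \<rightarrow> A\<close> of \<open>\<phi> : A \<rightarrow> B\<close>, as the composite
  \<open>B \<rightarrow> I \<otimes> B \<rightarrow> (A \<otimes> A) \<otimes> B \<rightarrow> A \<otimes> (A \<otimes> B) \<rightarrow> A \<otimes> (B \<otimes> B) \<rightarrow> A \<otimes> I \<rightarrow> A\<close>.\<close>

definition canonical_adjoint ::
    "'v::real_normed_vector com_category \<Rightarrow> ('v com \<Rightarrow> 'v \<Rightarrow> 'v) \<Rightarrow> ('v com \<Rightarrow> 'v \<Rightarrow> 'v) \<Rightarrow>
     'v com \<Rightarrow> 'v com \<Rightarrow> ('v \<Rightarrow> 'v) \<Rightarrow> 'v \<Rightarrow> 'v" where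
  "canonical_adjoint C \<gamma> f A B \<phi> =
     runit C A \<circ>
     tmap C A A (B \<otimes>\<^bsub>C\<^esub> B) \<I>\<^bsub>C\<^esub> (idm A) (f B) \<circ>
     tmap C A A (A \<otimes>\<^bsub>C\<^esub> B) (B \<otimes>\<^bsub>C\<^esub> B) (idm A) (tmap C A B B B \<phi> (idm B)) \<circ>
     assoc C A A B \<circ>
     tmap C \<I>\<^bsub>C\<^esub> (A \<otimes>\<^bsub>C\<^esub> A) B B (\<gamma> A) (idm B) \<circ>
     lunit_inv C B"


section \<open>Compact closed and dagger compact categories\<close>

definition is_dual ::
    "'v::real_normed_vector com_category \<Rightarrow> 'v com \<Rightarrow> 'v com \<Rightarrow> ('v \<Rightarrow> 'v) \<Rightarrow> ('v \<Rightarrow> 'v) \<Rightarrow> bool" where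
  "is_dual C A A' \<eta> \<epsilon> \<longleftrightarrow>
     A' \<in> Obj C \<and>
     \<eta> \<in> Hom C \<I>\<^bsub>C\<^esub> (A' \<otimes>\<^bsub>C\<^esub> A) \<and>
     \<epsilon> \<in> Hom C (A \<otimes>\<^bsub>C\<^esub> A') \<I>\<^bsub>C\<^esub> \<and>
     lunit C A \<circ> tmap C (A \<otimes>\<^bsub>C\<^esub> A') \<I>\<^bsub>C\<^esub> A A \<epsilon> (idm A) \<circ> assoc_inv C A A' A \<circ>
       tmap C A A \<I>\<^bsub>C\<^esub> (A' \<otimes>\<^bsub>C\<^esub> A) (idm A) \<eta> \<circ> runit_inv C A = idm A \<and>
     runit C A' \<circ> tmap C A' A' (A \<otimes>\<^bsub>C\<^esub> A') \<I>\<^bsub>C\<^esub> (idm A') \<epsilon> \<circ> assoc C A' A A' \<circ>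
       tmap C \<I>\<^bsub>C\<^esub> (A' \<otimes>\<^bsub>C\<^esub> A) A' A' \<eta> (idm A') \<circ> lunit_inv C A' = idm A'"

text \<open>A dagger gives, for \<open>\<phi> : A \<rightarrow> B\<close>, the morphism \<open>dag A B \<phi> : B \<rightarrow> A\<close>.\<close>

type_synonym 'v dagger = "'v com \<Rightarrow> 'v com \<Rightarrow> ('v \<Rightarrow> 'v) \<Rightarrow> 'v \<Rightarrow> 'v"

definition is_dagger :: "'v::real_normed_vector com_category \<Rightarrow> 'v dagger \<Rightarrow> bool" where
  "is_dagger C dag \<longleftrightarrow>
     (\<forall>A\<in>Obj C. \<forall>B\<in>Obj C. \<forall>\<phi>\<in>Hom C A B. dag A B \<phi> \<in> Hom C B A) \<and>
     (\<forall>A\<in>Obj C. dag A A (idm A) = idm A) \<and>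
     (\<forall>A\<in>Obj C. \<forall>B\<in>Obj C. \<forall>D\<in>Obj C. \<forall>\<phi>\<in>Hom C A B. \<forall>\<psi>\<in>Hom C B D.
        dag A D (\<psi> \<circ> \<phi>) = dag A B \<phi> \<circ> dag B D \<psi>) \<and>
     (\<forall>A\<in>Obj C. \<forall>B\<in>Obj C. \<forall>\<phi>\<in>Hom C A B. dag B A (dag A B \<phi>) = \<phi>)"

definition is_unitary ::
    "'v::real_normed_vector dagger \<Rightarrow> 'v com \<Rightarrow> 'v com \<Rightarrow> ('v \<Rightarrow> 'v) \<Rightarrow> bool" where
  "is_unitary dag A B \<phi> \<longleftrightarrow> dag A B \<phi> \<circ> \<phi> = idm A \<and> \<phi> \<circ> dag A B \<phi> = idm B"

definition dagger_monoidal :: "'v::real_normed_vector com_category \<Rightarrow> 'v dagger \<Rightarrow> bool" where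
  "dagger_monoidal C dag \<longleftrightarrow>
     is_dagger C dag \<and>
     (\<forall>A\<in>Obj C. \<forall>B\<in>Obj C. \<forall>D\<in>Obj C.
        is_unitary dag ((A \<otimes>\<^bsub>C\<^esub> B) \<otimes>\<^bsub>C\<^esub> D) (A \<otimes>\<^bsub>C\<^esub> (B \<otimes>\<^bsub>C\<^esub> D)) (assoc C A B D)) \<and>
     (\<forall>A\<in>Obj C. is_unitary dag (\<I>\<^bsub>C\<^esub> \<otimes>\<^bsub>C\<^esub> A) A (lunit C A)) \<and>
     (\<forall>A\<in>Obj C. is_unitary dag (A \<otimes>\<^bsub>C\<^esub> \<I>\<^bsub>C\<^esub>) A (runit C A)) \<and>
     (\<forall>A\<in>Obj C. \<forall>B\<in>Obj C. is_unitary dag (A \<otimes>\<^bsub>C\<^esub> B) (B \<otimes>\<^bsub>C\<^esub> A) (swap C A B)) \<and>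
     (\<forall>A\<in>Obj C. \<forall>A'\<in>Obj C. \<forall>B\<in>Obj C. \<forall>B'\<in>Obj C. \<forall>\<phi>\<in>Hom C A A'. \<forall>\<psi>\<in>Hom C B B'.
        dag (A \<otimes>\<^bsub>C\<^esub> B) (A' \<otimes>\<^bsub>C\<^esub> B') (tmap C A A' B B' \<phi> \<psi>) =
        tmap C A' A B' B (dag A A' \<phi>) (dag B B' \<psi>))"

text \<open>Dagger compactness with respect to the dagger \<open>dag\<close> and the compact structure given by the dual
  objects \<open>dl A\<close> with \<open>\<eta> A : I \<rightarrow> dl A \<otimes> A\<close> and \<open>\<epsilon> A : A \<otimes> dl A \<rightarrow> I\<close>.\<close>

definition dagger_compact ::
    "'v::real_normed_vector com_category \<Rightarrow> 'v dagger \<Rightarrow> ('v com \<Rightarrow> 'v com) \<Rightarrow>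
     ('v com \<Rightarrow> 'v \<Rightarrow> 'v) \<Rightarrow> ('v com \<Rightarrow> 'v \<Rightarrow> 'v) \<Rightarrow> bool" where
  "dagger_compact C dag dl \<eta> \<epsilon> \<longleftrightarrow>
     dagger_monoidal C dag \<and>
     (\<forall>A\<in>Obj C. is_dual C A (dl A) (\<eta> A) (\<epsilon> A)) \<and>
     (\<forall>A\<in>Obj C. \<eta> A = swap C A (dl A) \<circ> dag (A \<otimes>\<^bsub>C\<^esub> dl A) \<I>\<^bsub>C\<^esub> (\<epsilon> A))"

end

theory Submission
  imports Defs
begin

text \<open>
  A choice \<open>(\<gamma>\<^sub>A, f\<^sub>A)\<close> gives nondegenerate bilinear forms \<open>\<langle>x, y\<rangle>\<^sub>A = f\<^sub>A(x \<otimes> y)\<close>, and the canonical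
  adjoint is characterised by \<open>\<langle>x, \<phi>' y\<rangle>\<^sub>A = \<langle>\<phi> x, y\<rangle>\<^sub>B\<close>.  Hence \<open>'\<close> is contravariantly functorial, and by
  multiplicativity of the forms under \<open>\<otimes>\<close> it is monoidal and inverts the canonical isomorphisms,
  which are isometries.  The duality equations and \<open>\<gamma>\<^sub>A = \<sigma> \<circ> f\<^sub>A'\<close> only say that \<open>\<gamma>\<^sub>A\<close> inverts the form,
  so involutivity is all that is at stake.  If the forms are symmetric, which means
  that the \<open>\<gamma>\<^sub>A\<close> are, then \<open>\<phi>'' = \<phi>\<close>; conversely \<open>\<alpha>'' = \<alpha>\<close> for a state \<open>\<alpha> : I \<rightarrow> A\<close> reads
  \<open>\<langle>y, \<alpha>\<rangle>\<^sub>A = \<langle>\<alpha>, y\<rangle>\<^sub>A\<close>, and the states span \<open>A\<close>.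
\<close>

section \<open>Linear maps on subspaces\<close>

lemma lin_mapsI:
  assumes "\<And>x. x \<in> E \<Longrightarrow> h x \<in> F"
    and "\<And>x y. x \<in> E \<Longrightarrow> y \<in> E \<Longrightarrow> h (x + y) = h x + h y"
    and "\<And>c x. x \<in> E \<Longrightarrow> h (c *\<^sub>R x) = c *\<^sub>R h x"
    and "\<And>x. x \<notin> E \<Longrightarrow> h x = 0"
  shows "h \<in> lin_maps E F"
  using assms by (simp add: lin_maps_def linear_between_def)

lemma
  assumes "h \<in> lin_maps E F"
  shows lin_maps_in: "x \<in> E \<Longrightarrow> h x \<in> F"
    and lin_maps_add: "x \<in> E \<Longrightarrow> y \<in> E \<Longrightarrow> h (x + y) = h x + h y"
    and lin_maps_scale: "x \<in> E \<Longrightarrow> h (c *\<^sub>R x) = c *\<^sub>R h x"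
    and lin_maps_outside: "x \<notin> E \<Longrightarrow> h x = 0"
  using assms by (simp_all add: lin_maps_def linear_between_def)

text \<open>If 0 lies in \<open>E\<close>, homogeneity gives it; otherwise the extension by 0 does.
  This is what lets compositions vanish outside their domain.\<close>

lemma lin_maps_zero:
  assumes "h \<in> lin_maps E F"
  shows "h 0 = 0"
  using lin_maps_scale[OF assms, of 0 0] lin_maps_outside[OF assms, of 0] by auto

lemma lin_maps_diff:
  assumes "h \<in> lin_maps E F" "subspace E" "x \<in> E" "y \<in> E"
  shows "h (x - y) = h x - h y"
  using lin_maps_add[OF assms(1), of "x - y" y] assms by (simp add: subspace_diff)

text \<open>Stated for \<open>linear_between\<close>, because the sections of a bilinear map in
  \<open>bilinear_on\<close> are not extended by 0. An infinite index set makes both sums 0.\<close>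

lemma linear_between_sum:
  assumes h: "linear_between E F h" and E: "subspace E" and x: "\<And>i. i \<in> S \<Longrightarrow> x i \<in> E"
  shows "h (\<Sum>i\<in>S. c i *\<^sub>R x i) = (\<Sum>i\<in>S. c i *\<^sub>R h (x i))"
proof -
  have add: "\<And>x y. x \<in> E \<Longrightarrow> y \<in> E \<Longrightarrow> h (x + y) = h x + h y"
    and scale: "\<And>c x. x \<in> E \<Longrightarrow> h (c *\<^sub>R x) = c *\<^sub>R h x"
    using h by (simp_all add: linear_between_def)
  have "h 0 = 0"
    using scale[of 0 0] E by (simp add: subspace_0)
  then show ?thesis
    using x
    by (induction S rule: infinite_finite_induct)
      (simp_all add: add scale E subspace_scale subspace_sum)
qed

lemma lin_maps_sum:
  assumes "h \<in> lin_maps E F" "subspace E" "\<And>i. i \<in> S \<Longrightarrow> x i \<in> E"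
  shows "h (\<Sum>i\<in>S. c i *\<^sub>R x i) = (\<Sum>i\<in>S. c i *\<^sub>R h (x i))"
  by (rule linear_between_sum[of E F]) (use assms in \<open>simp_all add: lin_maps_def\<close>)

text \<open>Both maps are 0 off \<open>E\<close>, so agreement on \<open>E\<close> is equality of
  functions. The two codomains may differ.\<close>

lemma lin_maps_eqI:
  assumes "h \<in> lin_maps E F" "k \<in> lin_maps E G" "\<And>x. x \<in> E \<Longrightarrow> h x = k x"
  shows "h = k"
proof
  fix x
  show "h x = k x"
    using assms lin_maps_outside[of h E F x] lin_maps_outside[of k E G x] by (cases "x \<in> E") auto
qed

lemma lin_maps_comp:
  assumes "h \<in> lin_maps E F" "k \<in> lin_maps F G"
  shows "k \<circ> h \<in> lin_maps E G"
  using assms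
  by (intro lin_mapsI)
    (simp_all add: lin_maps_in lin_maps_add lin_maps_scale lin_maps_outside lin_maps_zero)

lemma subspace_lin_maps:
  assumes "subspace F"
  shows "subspace (lin_maps E F)"
  using assms unfolding subspace_def lin_maps_def linear_between_def
  by (auto simp: zero_fun_def plus_fun_def scaleR_fun_def algebra_simps)

lemma subspace_dual_space: "subspace (dual_space E)"
  unfolding dual_space_def by (rule subspace_lin_maps) simp

text \<open>\<open>inv_map\<close> picks preimages by choice; exhibiting a linear two-sided inverse
  replaces it by an explicit map.\<close>

lemma inv_map_eqI:
  assumes h: "h \<in> lin_maps E F" and k: "k \<in> lin_maps F E"
    and kh: "\<And>x. x \<in> E \<Longrightarrow> k (h x) = x" and hk: "\<And>y. y \<in> F \<Longrightarrow> h (k y) = y"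
  shows "inv_map E F h = k"
proof
  fix y
  have "inv_into E h y = k y" if "y \<in> F"
  proof (rule inv_into_f_eq)
    show "inj_on h E" by (metis inj_onI kh)
  qed (use that hk lin_maps_in[OF k] in auto)
  then show "inv_map E F h y = k y"
    using lin_maps_outside[OF k] by (simp add: inv_map_def)
qed

section \<open>Coordinates\<close>

lemma finite_independent_basis:
  assumes "finite B"
  obtains S where "finite S" "independent S" "span S = span B"
proof -
  obtain S where S: "S \<subseteq> span B" "independent S" "span B \<subseteq> span S"
    by (rule maximal_independent_subset)
  show thesis
  proof (rule that)
    show "finite S"
      using independent_span_bound[OF assms S(2,1)] ..
    show "span S = span B"
      by (rule subset_antisym[OF span_minimal[OF S(1) subspace_span] S(3)])
  qed (rule S(2))
qed

lemma sum_apply: "(\<Sum>i\<in>S. g i) x = (\<Sum>i\<in>S. g i x)"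
  for g :: "'i \<Rightarrow> 'a \<Rightarrow> 'b::comm_monoid_add"
  by (induction S rule: infinite_finite_induct) simp_all

text \<open>\<open>representation\<close> is 0 outside the span, which matches the convention of
  extension by 0. These functionals form the dual basis.\<close>

lemma coordinate_dual_space:
  assumes "independent S"
  shows "(\<lambda>x. representation S x e) \<in> dual_space (span S)"
  unfolding dual_space_def
  by (rule lin_mapsI)
    (simp_all add: assms representation_add representation_scale, simp add: representation_def)

lemma dual_space_coordinates:
  assumes "finite S" "independent S" "a \<in> dual_space (span S)"
  shows "a = (\<Sum>e\<in>S. a e *\<^sub>R (\<lambda>x. representation S x e))"
proof (rule lin_maps_eqI)
  show a: "a \<in> lin_maps (span S) UNIV" using assms(3) by (simp add: dual_space_def)
  show "(\<Sum>e\<in>S. a e *\<^sub>R (\<lambda>x. representation S x e)) \<in> lin_maps (span S) UNIV"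
    using subspace_dual_space[of "span S"] coordinate_dual_space[OF assms(2)]
    by (simp add: dual_space_def subspace_sum subspace_scale)
  fix x assume x: "x \<in> span S"
  have "a x = a (\<Sum>e\<in>S. representation S x e *\<^sub>R e)"
    using sum_representation_eq[OF assms(2) x assms(1)] by simp
  also have "\<dots> = (\<Sum>e\<in>S. representation S x e *\<^sub>R a e)"
    by (rule lin_maps_sum[OF a]) (auto simp: span_base)
  finally show "a x = (\<Sum>e\<in>S. a e *\<^sub>R (\<lambda>x. representation S x e)) x"
    by (simp add: sum_apply scaleR_fun_def mult.commute)
qed

text \<open>The coordinate functionals of a basis already separate points.\<close>

lemma dual_space_separates:
  assumes "finite B" "x \<in> span B" "y \<in> span B"
    and eq: "\<And>a. a \<in> dual_space (span B) \<Longrightarrow> a x = a y"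
  shows "x = y"
proof -
  obtain S where S: "finite S" "independent S" "span S = span B"
    by (rule finite_independent_basis[OF assms(1)])
  have eq': "representation S x e = representation S y e" for e
    by (rule eq[OF coordinate_dual_space[OF S(2), of e, unfolded S(3)]])
  have "x = (\<Sum>e\<in>S. representation S x e *\<^sub>R e)"
    using sum_representation_eq[OF S(2) _ S(1) order_refl] S(3) assms(2) by simp
  also have "\<dots> = (\<Sum>e\<in>S. representation S y e *\<^sub>R e)"
    by (simp only: eq')
  also have "\<dots> = y"
    using sum_representation_eq[OF S(2) _ S(1) order_refl] S(3) assms(3) by simp
  finally show ?thesis .
qed

text \<open>Expand \<open>a\<close> and \<open>b\<close> in the dual bases: a bilinear form on the
  duals is determined by its matrix at pairs of coordinate functionals.\<close>

lemma bilinear_forms_coordinates: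
  assumes S: "finite S" "independent S" and T: "finite T" "independent T"
    and w: "w \<in> bilinear_forms (dual_space (span S)) (dual_space (span T))"
    and a: "a \<in> dual_space (span S)" and b: "b \<in> dual_space (span T)"
  shows "w a b = (\<Sum>e\<in>S. \<Sum>d\<in>T.
    w (\<lambda>x. representation S x e) (\<lambda>x. representation T x d) * (a e * b d))"
proof -
  have wa: "w a' \<in> lin_maps (dual_space (span T)) UNIV" for a'
    using w by (simp add: bilinear_forms_def dual_space_def)
  have wb: "(\<lambda>a. w a b') \<in> lin_maps (dual_space (span S)) UNIV" for b'
    using w by (simp add: bilinear_forms_def dual_space_def)
  have "w a b = (\<lambda>a. w a b) (\<Sum>e\<in>S. a e *\<^sub>R (\<lambda>x. representation S x e))"
    using dual_space_coordinates[OF S a] by simp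
  also have "\<dots> = (\<Sum>e\<in>S. a e *\<^sub>R w (\<lambda>x. representation S x e) b)"
    by (rule lin_maps_sum[OF wb subspace_dual_space coordinate_dual_space[OF S(2)]])
  also have "\<dots> = (\<Sum>e\<in>S. a e *\<^sub>R w (\<lambda>x. representation S x e)
      (\<Sum>d\<in>T. b d *\<^sub>R (\<lambda>x. representation T x d)))"
    using dual_space_coordinates[OF T b] by simp
  also have "\<dots> = (\<Sum>e\<in>S. a e *\<^sub>R (\<Sum>d\<in>T. b d *\<^sub>R w (\<lambda>x. representation S x e)
      (\<lambda>x. representation T x d)))"
    by (simp add: lin_maps_sum[OF wa subspace_dual_space coordinate_dual_space[OF T(2)]])
  finally show ?thesis
    by (simp add: sum_distrib_left mult_ac)
qed

text \<open>In contrast to \<open>bilinear_forms\<close>, values outside \<open>E\<close> and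
  \<open>F\<close> are unconstrained and the target is any subspace, so that terms such as
  \<open>tvec C B A \<beta> \<alpha>\<close> can be used as they stand.\<close>

definition bilinear_on ::
    "'a::real_vector set \<Rightarrow> 'b::real_vector set \<Rightarrow> 'c::real_vector set \<Rightarrow> ('a \<Rightarrow> 'b \<Rightarrow> 'c) \<Rightarrow> bool" where
  "bilinear_on E F W h \<longleftrightarrow>
     (\<forall>x\<in>E. linear_between F W (h x)) \<and> (\<forall>y\<in>F. linear_between E W (\<lambda>x. h x y))"

lemma bilinear_onI:
  assumes "\<And>x y. x \<in> E \<Longrightarrow> y \<in> F \<Longrightarrow> h x y \<in> W"
    and "\<And>x x' y. x \<in> E \<Longrightarrow> x' \<in> E \<Longrightarrow> y \<in> F \<Longrightarrow> h (x + x') y = h x y + h x' y"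
    and "\<And>c x y. x \<in> E \<Longrightarrow> y \<in> F \<Longrightarrow> h (c *\<^sub>R x) y = c *\<^sub>R h x y"
    and "\<And>x y y'. x \<in> E \<Longrightarrow> y \<in> F \<Longrightarrow> y' \<in> F \<Longrightarrow> h x (y + y') = h x y + h x y'"
    and "\<And>c x y. x \<in> E \<Longrightarrow> y \<in> F \<Longrightarrow> h x (c *\<^sub>R y) = c *\<^sub>R h x y"
  shows "bilinear_on E F W h"
  using assms by (simp add: bilinear_on_def linear_between_def)

lemma bilinear_on_coordinates:
  assumes S: "finite S" "independent S" and T: "finite T" "independent T"
    and h: "bilinear_on (span S) (span T) W h"
    and x: "x \<in> span S" and y: "y \<in> span T"
  shows "h x y = (\<Sum>e\<in>S. \<Sum>d\<in>T. (representation S x e * representation T y d) *\<^sub>R h e d)"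
proof -
  have hx: "linear_between (span T) W (h x')" if "x' \<in> span S" for x'
    using h that by (simp add: bilinear_on_def)
  have hy: "linear_between (span S) W (\<lambda>x. h x y)"
    using h y by (simp add: bilinear_on_def)
  have "h x y = (\<lambda>x. h x y) (\<Sum>e\<in>S. representation S x e *\<^sub>R e)"
    using sum_representation_eq[OF S(2) x S(1)] by simp
  also have "\<dots> = (\<Sum>e\<in>S. representation S x e *\<^sub>R h e y)"
    by (rule linear_between_sum[OF hy]) (auto simp: span_base)
  also have "\<dots> = (\<Sum>e\<in>S. representation S x e *\<^sub>R h e (\<Sum>d\<in>T. representation T y d *\<^sub>R d))"
    using sum_representation_eq[OF T(2) y T(1)] by simp
  also have "\<dots> = (\<Sum>e\<in>S. representation S x e *\<^sub>R (\<Sum>d\<in>T. representation T y d *\<^sub>R h e d))"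
    by (intro sum.cong refl arg_cong[where f="scaleR _"] linear_between_sum[OF hx])
      (auto simp: span_base)
  finally show ?thesis
    by (simp add: scaleR_sum_right)
qed

section \<open>Tensor products of convex operational models\<close>

lemma is_com_basis:
  assumes "is_com A"
  obtains S where "finite S" "independent S" "span S = com_space A"
proof -
  obtain B where B: "finite B" "com_space A = span B"
    using assms by (auto simp: is_com_def)
  show thesis
    using that B(2) by (auto intro: finite_independent_basis[OF B(1)])
qed

lemma subspace_com_space: "is_com A \<Longrightarrow> subspace (com_space A)"
  by (auto simp: is_com_def)

lemma com_space_diffE:
  assumes "is_com A" "\<alpha> \<in> com_space A"
  obtains x y where "x \<in> com_pos A" "y \<in> com_pos A" "\<alpha> = x - y"
  using assms by (auto simp: is_com_def regular_cone_def)

lemma com_pos_subset: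
  assumes "is_com A"
  shows "com_pos A \<subseteq> com_space A"
proof
  fix x assume "x \<in> com_pos A"
  moreover have "0 \<in> com_pos A" "com_space A = {x - y | x y. x \<in> com_pos A \<and> y \<in> com_pos A}"
    using assms by (auto simp: is_com_def regular_cone_def)
  ultimately have "\<exists>y z. x = y - z \<and> y \<in> com_pos A \<and> z \<in> com_pos A"
    by (intro exI[of _ x] exI[of _ 0]) simp
  then show "x \<in> com_space A"
    using \<open>com_space A = _\<close> by simp
qed

lemma com_dual_separates:
  assumes "is_com A" "x \<in> com_space A" "y \<in> com_space A"
    and "\<And>a. a \<in> com_dual A \<Longrightarrow> a x = a y"
  shows "x = y"
proof -
  obtain S where "finite S" "span S = com_space A"
    by (rule is_com_basis[OF assms(1)])
  then show ?thesis
    using dual_space_separates[of S x y] assms(2-) by simp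
qed

lemma
  assumes "a \<in> dual_space E"
  shows dual_space_add: "x \<in> E \<Longrightarrow> y \<in> E \<Longrightarrow> a (x + y) = a x + a y"
    and dual_space_scale: "x \<in> E \<Longrightarrow> a (c *\<^sub>R x) = c * a x"
  using lin_maps_add[of a E UNIV x y] lin_maps_scale[of a E UNIV x c] assms
  by (simp_all add: dual_space_def)

locale monoidal_coms =
  fixes C :: "'v::real_normed_vector com_category" (structure)
  assumes monoidal: "monoidal_category_of_coms C"
begin

lemma category: "category_of_coms C"
  using monoidal by (simp add: monoidal_category_of_coms_def)

lemma one_vec_nonzero: "one_vec C \<noteq> 0"
  using category by (simp add: category_of_coms_def)

lemma Obj_is_com: "A \<in> Obj C \<Longrightarrow> is_com A"
  using category by (simp add: category_of_coms_def)

lemma subspace_Obj: "A \<in> Obj C \<Longrightarrow> subspace (com_space A)"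
  by (simp add: Obj_is_com subspace_com_space)

lemma
  assumes "A \<in> Obj C"
  shows com_space_zero [simp]: "0 \<in> com_space A"
    and com_space_add [simp]: "x \<in> com_space A \<Longrightarrow> y \<in> com_space A \<Longrightarrow> x + y \<in> com_space A"
    and com_space_scale [simp]: "x \<in> com_space A \<Longrightarrow> c *\<^sub>R x \<in> com_space A"
  using subspace_Obj[OF assms] by (simp_all add: subspace_0 subspace_add subspace_scale)

lemma I_Obj [simp]: "\<I> \<in> Obj C"
  using category by (simp add: category_of_coms_def)

lemma tensor_Obj [simp]: "A \<in> Obj C \<Longrightarrow> B \<in> Obj C \<Longrightarrow> A \<otimes> B \<in> Obj C"
  using monoidal by (simp add: monoidal_category_of_coms_def)

lemma composite: "A \<in> Obj C \<Longrightarrow> B \<in> Obj C \<Longrightarrow> is_composite A B (A \<otimes> B) (form C A B)"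
  using monoidal by (simp add: monoidal_category_of_coms_def)

lemma Hom_lin: "\<phi> \<in> Hom C A B \<Longrightarrow> A \<in> Obj C \<Longrightarrow> B \<in> Obj C \<Longrightarrow> \<phi> \<in> lin A B"
  using category unfolding category_of_coms_def com_morphisms_def by blast

lemma Hom_comp:
  assumes "\<phi> \<in> Hom C A B" "\<psi> \<in> Hom C B D" "A \<in> Obj C" "B \<in> Obj C" "D \<in> Obj C"
  shows "\<psi> \<circ> \<phi> \<in> Hom C A D"
proof -
  have "\<forall>A\<in>Obj C. \<forall>B\<in>Obj C. \<forall>D\<in>Obj C. \<forall>\<phi>\<in>Hom C A B. \<forall>\<psi>\<in>Hom C B D. \<psi> \<circ> \<phi> \<in> Hom C A D"
    using category by (simp add: category_of_coms_def)
  from this[rule_format, OF assms(3-5,1,2)] show ?thesis .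
qed

lemma idm_Hom: "A \<in> Obj C \<Longrightarrow> idm A \<in> Hom C A A"
  using category by (simp add: category_of_coms_def)

lemma idm_lin [simp]: "A \<in> Obj C \<Longrightarrow> idm A \<in> lin A A"
  by (simp add: idm_Hom Hom_lin)

lemma
  assumes "\<phi> \<in> lin A B"
  shows lin_in: "x \<in> com_space A \<Longrightarrow> \<phi> x \<in> com_space B"
    and lin_add: "x \<in> com_space A \<Longrightarrow> y \<in> com_space A \<Longrightarrow> \<phi> (x + y) = \<phi> x + \<phi> y"
    and lin_scale: "x \<in> com_space A \<Longrightarrow> \<phi> (c *\<^sub>R x) = c *\<^sub>R \<phi> x"
    and lin_outside: "x \<notin> com_space A \<Longrightarrow> \<phi> x = 0"
  using assms
  by (simp_all add: lin_def lin_maps_in lin_maps_add lin_maps_scale lin_maps_outside)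

lemma lin_comp: "\<phi> \<in> lin A B \<Longrightarrow> \<psi> \<in> lin B D \<Longrightarrow> \<psi> \<circ> \<phi> \<in> lin A D"
  unfolding lin_def by (rule lin_maps_comp)

lemma lin_eqI:
  assumes "\<phi> \<in> lin A B" "\<psi> \<in> lin A B" "\<And>x. x \<in> com_space A \<Longrightarrow> \<phi> x = \<psi> x"
  shows "\<phi> = \<psi>"
  using assms(1,2) unfolding lin_def by (rule lin_maps_eqI) (rule assms(3))

lemma idm_apply [simp]: "x \<in> com_space A \<Longrightarrow> idm A x = x"
  by (simp add: idm_def id_map_def)

section \<open>Product vectors and the universal property of the composite\<close>

lemma form_lin_maps:
  "A \<in> Obj C \<Longrightarrow> B \<in> Obj C \<Longrightarrow>
    form C A B \<in> lin_maps (com_space (A \<otimes> B)) (bilinear_forms (com_dual A) (com_dual B))"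
  using composite by (simp add: is_composite_def)

text \<open>A composite is only required to contain products of positive vectors. The cones
  generate, so \<alpha> and \<beta> are differences of positive vectors, and the product form of
  \<alpha> and \<beta> is a combination of four admissible ones.\<close>

lemma
  assumes A: "A \<in> Obj C" and B: "B \<in> Obj C"
    and \<alpha>: "\<alpha> \<in> com_space A" and \<beta>: "\<beta> \<in> com_space B"
  shows tvec_in [simp]: "tvec C A B \<alpha> \<beta> \<in> com_space (A \<otimes> B)"
    and form_tvec: "form C A B (tvec C A B \<alpha> \<beta>) = product_form A B \<alpha> \<beta>"
proof -
  let ?F = "form C A B" and ?V = "com_space (A \<otimes> B)"
  obtain x x' where x: "x \<in> com_pos A" "x' \<in> com_pos A" "\<alpha> = x - x'"
    using com_space_diffE[OF Obj_is_com[OF A] \<alpha>] .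
  obtain y y' where y: "y \<in> com_pos B" "y' \<in> com_pos B" "\<beta> = y - y'"
    using com_space_diffE[OF Obj_is_com[OF B] \<beta>] .
  have V: "subspace ?V" and pos: "com_pos (A \<otimes> B) \<subseteq> ?V"
    using A B by (simp_all add: subspace_Obj com_pos_subset Obj_is_com)
  have im: "\<exists>\<omega>\<in>?V. ?F \<omega> = product_form A B z w" if "z \<in> com_pos A" "w \<in> com_pos B" for z w
  proof -
    have "product_form A B z w \<in> ?F ` com_pos (A \<otimes> B)"
      using composite[OF A B] that by (simp add: is_composite_def)
    then show ?thesis using pos by force
  qed
  obtain p q r s where pqrs: "p \<in> ?V" "q \<in> ?V" "r \<in> ?V" "s \<in> ?V"
      "?F p = product_form A B x y" "?F q = product_form A B x y'"
      "?F r = product_form A B x' y" "?F s = product_form A B x' y'"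
    using im[OF x(1) y(1)] im[OF x(1) y(2)] im[OF x(2) y(1)] im[OF x(2) y(2)] by blast
  \<comment> \<open>This combination is the expansion of (x - x') \<otimes> (y - y').\<close>
  have "?F ((p - q) - (r - s)) = (?F p - ?F q) - (?F r - ?F s)"
    using pqrs(1-4) V by (simp add: lin_maps_diff[OF form_lin_maps[OF A B] V] subspace_diff)
  also have "\<dots> = product_form A B \<alpha> \<beta>"
  proof (intro ext)
    fix a b
    have a: "a (x - x') = a x - a x'" if "a \<in> com_dual A"
      by (rule lin_maps_diff[of _ "com_space A" UNIV])
        (use that x com_pos_subset[OF Obj_is_com[OF A]] subspace_Obj[OF A]
          in \<open>auto simp: dual_space_def\<close>)
    have b: "b (y - y') = b y - b y'" if "b \<in> com_dual B"
      by (rule lin_maps_diff[of _ "com_space B" UNIV])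
        (use that y com_pos_subset[OF Obj_is_com[OF B]] subspace_Obj[OF B]
          in \<open>auto simp: dual_space_def\<close>)
    show "((?F p - ?F q) - (?F r - ?F s)) a b = product_form A B \<alpha> \<beta> a b"
      unfolding pqrs x(3) y(3) by (auto simp: product_form_def a b algebra_simps)
  qed
  finally have "product_form A B \<alpha> \<beta> \<in> ?F ` ?V"
    using pqrs(1-4) V by (metis imageI subspace_diff)
  then show "tvec C A B \<alpha> \<beta> \<in> ?V" "?F (tvec C A B \<alpha> \<beta>) = product_form A B \<alpha> \<beta>"
    unfolding tvec_def by (rule inv_into_into, rule f_inv_into_f)
qed

lemma inj_on_form: "A \<in> Obj C \<Longrightarrow> B \<in> Obj C \<Longrightarrow> inj_on (form C A B) (com_space (A \<otimes> B))"
  using composite by (simp add: is_composite_def)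

text \<open>\<open>tvec\<close> is a choice of preimage under \<open>form\<close>. Since
  \<open>form\<close> is injective and linear, it suffices to compare the product forms, which are
  bilinear in the two vectors.\<close>

lemma
  assumes A: "A \<in> Obj C" and B: "B \<in> Obj C"
    and \<alpha>: "\<alpha> \<in> com_space A" and \<beta>: "\<beta> \<in> com_space B"
  shows tvec_add_left: "\<alpha>' \<in> com_space A \<Longrightarrow>
      tvec C A B (\<alpha> + \<alpha>') \<beta> = tvec C A B \<alpha> \<beta> + tvec C A B \<alpha>' \<beta>"
    and tvec_add_right: "\<beta>' \<in> com_space B \<Longrightarrow>
      tvec C A B \<alpha> (\<beta> + \<beta>') = tvec C A B \<alpha> \<beta> + tvec C A B \<alpha> \<beta>'"
    and tvec_scale_left: "tvec C A B (c *\<^sub>R \<alpha>) \<beta> = c *\<^sub>R tvec C A B \<alpha> \<beta>"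
    and tvec_scale_right: "tvec C A B \<alpha> (c *\<^sub>R \<beta>) = c *\<^sub>R tvec C A B \<alpha> \<beta>"
proof -
  note F = form_lin_maps[OF A B]
  show "tvec C A B (\<alpha> + \<alpha>') \<beta> = tvec C A B \<alpha> \<beta> + tvec C A B \<alpha>' \<beta>" if "\<alpha>' \<in> com_space A"
    using that A B \<alpha> \<beta>
    by (intro inj_onD[OF inj_on_form[OF A B]])
      (auto simp: form_tvec lin_maps_add[OF F] product_form_def fun_eq_iff distrib_right
        dual_space_add[of _ "com_space A"])
  show "tvec C A B \<alpha> (\<beta> + \<beta>') = tvec C A B \<alpha> \<beta> + tvec C A B \<alpha> \<beta>'" if "\<beta>' \<in> com_space B"
    using that A B \<alpha> \<beta>
    by (intro inj_onD[OF inj_on_form[OF A B]])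
      (auto simp: form_tvec lin_maps_add[OF F] product_form_def fun_eq_iff distrib_left
        dual_space_add[of _ "com_space B"])
  show "tvec C A B (c *\<^sub>R \<alpha>) \<beta> = c *\<^sub>R tvec C A B \<alpha> \<beta>"
    using A B \<alpha> \<beta>
    by (intro inj_onD[OF inj_on_form[OF A B]])
      (auto simp: form_tvec lin_maps_scale[OF F] product_form_def fun_eq_iff scaleR_fun_def
        dual_space_scale[of _ "com_space A"])
  show "tvec C A B \<alpha> (c *\<^sub>R \<beta>) = c *\<^sub>R tvec C A B \<alpha> \<beta>"
    using A B \<alpha> \<beta>
    by (intro inj_onD[OF inj_on_form[OF A B]])
      (auto simp: form_tvec lin_maps_scale[OF F] product_form_def fun_eq_iff scaleR_fun_def
        dual_space_scale[of _ "com_space B"])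
qed

text \<open>The product vectors of two bases span the composite. The coefficients of \<omega> are
  the entries of its form at the dual bases; both sides then have the same form, and
  \<open>form\<close> is injective.\<close>

lemma tvec_expand:
  assumes A: "A \<in> Obj C" and B: "B \<in> Obj C" and \<omega>: "\<omega> \<in> com_space (A \<otimes> B)"
    and S: "finite S" "independent S" "span S = com_space A"
    and T: "finite T" "independent T" "span T = com_space B"
  shows "\<omega> = (\<Sum>(e, d)\<in>S \<times> T.
    form C A B \<omega> (\<lambda>x. representation S x e) (\<lambda>x. representation T x d) *\<^sub>R tvec C A B e d)"
    (is "\<omega> = ?\<omega>'")
proof (rule inj_onD[OF inj_on_form[OF A B] _ \<omega>])
  let ?F = "form C A B" and ?V = "com_space (A \<otimes> B)"
  let ?c = "\<lambda>(e, d). form C A B \<omega> (\<lambda>x. representation S x e) (\<lambda>x. representation T x d)"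
  have V: "subspace ?V" using A B by (simp add: subspace_Obj)
  have ST: "S \<subseteq> com_space A" "T \<subseteq> com_space B"
    using span_superset[of S] span_superset[of T] S(3) T(3) by simp_all
  have t: "(\<lambda>(e, d). tvec C A B e d) i \<in> ?V" if "i \<in> S \<times> T" for i
    using that A B ST by (auto intro!: tvec_in)
  have \<omega>': "?\<omega>' = (\<Sum>i\<in>S \<times> T. ?c i *\<^sub>R (\<lambda>(e, d). tvec C A B e d) i)"
    by (intro sum.cong) auto
  show "?\<omega>' \<in> ?V"
    unfolding \<omega>' using V t by (intro subspace_sum subspace_scale)
  have w: "?F \<omega> \<in> bilinear_forms (com_dual A) (com_dual B)"
    using form_lin_maps[OF A B] \<omega> by (rule lin_maps_in)
  have "?F ?\<omega>' = (\<Sum>i\<in>S \<times> T. ?c i *\<^sub>R ?F ((\<lambda>(e, d). tvec C A B e d) i))"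
    unfolding \<omega>' using form_lin_maps[OF A B] V t by (rule lin_maps_sum)
  also have "\<dots> = (\<Sum>(e, d)\<in>S \<times> T. ?c (e, d) *\<^sub>R product_form A B e d)"
    using ST A B by (intro sum.cong) (auto simp: form_tvec subset_iff)
  also have "\<dots> = ?F \<omega>"
  proof (intro ext)
    fix a b
    show "(\<Sum>(e, d)\<in>S \<times> T. ?c (e, d) *\<^sub>R product_form A B e d) a b = ?F \<omega> a b"
    proof (cases "a \<in> com_dual A \<and> b \<in> com_dual B")
      case True
      then show ?thesis
        using bilinear_forms_coordinates[OF S(1,2) T(1,2), of "?F \<omega>" a b] w S(3) T(3)
        by (simp add: sum_apply scaleR_fun_def product_form_def sum.cartesian_product case_prod_beta)
    next
      \<comment> \<open>Off the dual spaces both the form of \<omega> and the product forms take the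
        default value 0.\<close>
      case False
      then have "?F \<omega> a b = 0"
        using w lin_maps_outside[of "?F \<omega> a" "com_dual B" UNIV b]
          lin_maps_outside[of "\<lambda>a. ?F \<omega> a b" "com_dual A" UNIV a]
        by (auto simp: bilinear_forms_def dual_space_def[of "dual_space _"])
      then show ?thesis
        by (simp add: sum_apply scaleR_fun_def product_form_def case_prod_beta if_not_P[OF False]
            del: de_Morgan_conj)
    qed
  qed
  finally show "?F \<omega> = ?F ?\<omega>'" ..
qed

text \<open>The principle behind nearly all later identities: check product vectors and additivity.
  Scalars need no case of their own, since a multiple of a product vector is again one.\<close>

lemma tensor_induct [consumes 3, case_names tvec add]:
  assumes A: "A \<in> Obj C" and B: "B \<in> Obj C" and \<omega>: "\<omega> \<in> com_space (A \<otimes> B)"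
    and tvec: "\<And>\<alpha> \<beta>. \<alpha> \<in> com_space A \<Longrightarrow> \<beta> \<in> com_space B \<Longrightarrow> P (tvec C A B \<alpha> \<beta>)"
    and add: "\<And>x y. x \<in> com_space (A \<otimes> B) \<Longrightarrow> y \<in> com_space (A \<otimes> B) \<Longrightarrow> P x \<Longrightarrow> P y \<Longrightarrow> P (x + y)"
  shows "P \<omega>"
proof -
  obtain S where S: "finite S" "independent S" "span S = com_space A"
    using A by (rule is_com_basis[OF Obj_is_com])
  obtain T where T: "finite T" "independent T" "span T = com_space B"
    using B by (rule is_com_basis[OF Obj_is_com])
  have mem: "e \<in> com_space A" "d \<in> com_space B" if "(e, d) \<in> S \<times> T" for e d
    using that span_superset[of S] span_superset[of T] S(3) T(3) by auto
  \<comment> \<open>The vector 0 is itself the product of 0 and 0, which supplies the empty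
    sum.\<close>
  have zero: "P 0"
    using tvec[of 0 0] tvec_scale_left[OF A B, of 0 0 0] A B by simp
  have "(\<Sum>(e, d)\<in>U. c (e, d) *\<^sub>R tvec C A B e d) \<in> com_space (A \<otimes> B) \<and>
      P (\<Sum>(e, d)\<in>U. c (e, d) *\<^sub>R tvec C A B e d)" if "finite U" "U \<subseteq> S \<times> T" for U c
    using that
  proof (induction U)
    case (insert i U)
    obtain e d where i: "i = (e, d)" by force
    have ed: "e \<in> com_space A" "d \<in> com_space B" using mem insert.prems i by auto
    have "P (c (e, d) *\<^sub>R tvec C A B e d)"
      using tvec[of "c (e, d) *\<^sub>R e" d] ed A B by (simp add: tvec_scale_left)
    then show ?case
      using insert ed A B by (auto simp: i intro!: add)
  qed (use zero A B in simp_all)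
  from this[of "S \<times> T" "\<lambda>(e, d). form C A B \<omega> (\<lambda>x. representation S x e) (\<lambda>x. representation T x d)"]
  show ?thesis
    using tvec_expand[OF A B \<omega> S T] S(1) T(1) by simp
qed

lemma tensor_eqI:
  assumes A: "A \<in> Obj C" and B: "B \<in> Obj C"
    and h: "h \<in> lin_maps (com_space (A \<otimes> B)) W" and k: "k \<in> lin_maps (com_space (A \<otimes> B)) W'"
    and eq: "\<And>\<alpha> \<beta>. \<alpha> \<in> com_space A \<Longrightarrow> \<beta> \<in> com_space B \<Longrightarrow> h (tvec C A B \<alpha> \<beta>) = k (tvec C A B \<alpha> \<beta>)"
  shows "h = k"
proof (rule lin_maps_eqI[OF h k])
  fix \<omega> assume "\<omega> \<in> com_space (A \<otimes> B)"
  with A B show "h \<omega> = k \<omega>"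
    by (induction rule: tensor_induct) (simp_all add: eq lin_maps_add[OF h] lin_maps_add[OF k])
qed

text \<open>Stated with unique existence, so that the maps defined by \<open>THE\<close> on product
  vectors can be unfolded through \<open>theI'\<close>. Uniqueness is
  \<open>tensor_eqI\<close>.\<close>

lemma tensor_universal:
  assumes A: "A \<in> Obj C" and B: "B \<in> Obj C" and W: "subspace W"
    and h: "bilinear_on (com_space A) (com_space B) W h"
  shows "\<exists>!k. k \<in> lin_maps (com_space (A \<otimes> B)) W \<and>
    (\<forall>\<alpha>\<in>com_space A. \<forall>\<beta>\<in>com_space B. k (tvec C A B \<alpha> \<beta>) = h \<alpha> \<beta>)"
proof (rule ex_ex1I)
  obtain S where S: "finite S" "independent S" "span S = com_space A"
    using A by (rule is_com_basis[OF Obj_is_com])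
  obtain T where T: "finite T" "independent T" "span T = com_space B"
    using B by (rule is_com_basis[OF Obj_is_com])
  let ?F = "form C A B" and ?V = "com_space (A \<otimes> B)"
  \<comment> \<open>Linear extension from a basis of product vectors, with the coordinates of
    \<omega> read off from its form. At a product vector these coordinates are products of the
    coordinates of the factors, which gives back \<open>h\<close>.\<close>
  define k where "k \<omega> = (\<Sum>e\<in>S. \<Sum>d\<in>T.
    ?F \<omega> (\<lambda>x. representation S x e) (\<lambda>x. representation T x d) *\<^sub>R h e d)" for \<omega>
  have "k \<in> lin_maps ?V W"
  proof (rule lin_mapsI)
    fix \<omega> assume "\<omega> \<in> ?V"
    have "h e d \<in> W" if "e \<in> S" "d \<in> T" for e d
      using h that span_superset[of S] span_superset[of T] S(3) T(3)
      unfolding bilinear_on_def linear_between_def by blast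
    then show "k \<omega> \<in> W"
      unfolding k_def using W by (intro subspace_sum subspace_scale)
  next
    show "k (x + y) = k x + k y" if "x \<in> ?V" "y \<in> ?V" for x y
      using that
      by (simp add: k_def lin_maps_add[OF form_lin_maps[OF A B]] scaleR_add_left sum.distrib)
    show "k (c *\<^sub>R x) = c *\<^sub>R k x" if "x \<in> ?V" for c x
      using that
      by (simp add: k_def lin_maps_scale[OF form_lin_maps[OF A B]] scaleR_sum_right scaleR_fun_def)
    show "k x = 0" if "x \<notin> ?V" for x
      using that by (simp add: k_def lin_maps_outside[OF form_lin_maps[OF A B]])
  qed
  moreover have "k (tvec C A B \<alpha> \<beta>) = h \<alpha> \<beta>" if "\<alpha> \<in> com_space A" "\<beta> \<in> com_space B" for \<alpha> \<beta>
    using bilinear_on_coordinates[OF S(1,2) T(1,2), of W h \<alpha> \<beta>] h that S(3) T(3)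
      coordinate_dual_space[OF S(2)] coordinate_dual_space[OF T(2)] A B
    by (simp add: k_def form_tvec product_form_def)
  ultimately show "\<exists>k. k \<in> lin_maps ?V W \<and>
      (\<forall>\<alpha>\<in>com_space A. \<forall>\<beta>\<in>com_space B. k (tvec C A B \<alpha> \<beta>) = h \<alpha> \<beta>)"
    by blast
qed (rule tensor_eqI[OF A B, where W=W and W'=W], auto)

section \<open>The structural isomorphisms on product vectors\<close>

lemma
  assumes "\<phi> \<in> lin A A'" "\<psi> \<in> lin B B'"
    and "A \<in> Obj C" "A' \<in> Obj C" "B \<in> Obj C" "B' \<in> Obj C"
  shows tmap_lin [simp]: "tmap C A A' B B' \<phi> \<psi> \<in> lin (A \<otimes> B) (A' \<otimes> B')"
    and tmap_tvec [simp]: "\<alpha> \<in> com_space A \<Longrightarrow> \<beta> \<in> com_space B \<Longrightarrow>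
      tmap C A A' B B' \<phi> \<psi> (tvec C A B \<alpha> \<beta>) = tvec C A' B' (\<phi> \<alpha>) (\<psi> \<beta>)"
proof -
  have "bilinear_on (com_space A) (com_space B) (com_space (A' \<otimes> B')) (\<lambda>\<alpha> \<beta>. tvec C A' B' (\<phi> \<alpha>) (\<psi> \<beta>))"
    using assms
    by (intro bilinear_onI)
      (simp_all add: lin_in[OF assms(1)] lin_in[OF assms(2)] lin_add[OF assms(1)]
        lin_add[OF assms(2)] lin_scale[OF assms(1)] lin_scale[OF assms(2)]
        tvec_add_left tvec_add_right tvec_scale_left tvec_scale_right)
  from theI'[OF tensor_universal[OF assms(3,5) subspace_Obj[OF tensor_Obj[OF assms(4,6)]] this]]
  show "tmap C A A' B B' \<phi> \<psi> \<in> lin (A \<otimes> B) (A' \<otimes> B')"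
    "\<alpha> \<in> com_space A \<Longrightarrow> \<beta> \<in> com_space B \<Longrightarrow>
      tmap C A A' B B' \<phi> \<psi> (tvec C A B \<alpha> \<beta>) = tvec C A' B' (\<phi> \<alpha>) (\<psi> \<beta>)"
    by (simp_all add: tmap_def lin_def)
qed

lemma
  assumes "A \<in> Obj C" "B \<in> Obj C"
  shows swap_lin [simp]: "swap C A B \<in> lin (A \<otimes> B) (B \<otimes> A)"
    and swap_tvec [simp]: "\<alpha> \<in> com_space A \<Longrightarrow> \<beta> \<in> com_space B \<Longrightarrow>
      swap C A B (tvec C A B \<alpha> \<beta>) = tvec C B A \<beta> \<alpha>"
proof -
  have "bilinear_on (com_space A) (com_space B) (com_space (B \<otimes> A)) (\<lambda>\<alpha> \<beta>. tvec C B A \<beta> \<alpha>)"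
    using assms
    by (intro bilinear_onI)
      (simp_all add: tvec_add_left tvec_add_right tvec_scale_left tvec_scale_right)
  from theI'[OF tensor_universal[OF assms subspace_Obj[OF tensor_Obj[OF assms(2,1)]] this]]
  show "swap C A B \<in> lin (A \<otimes> B) (B \<otimes> A)"
    "\<alpha> \<in> com_space A \<Longrightarrow> \<beta> \<in> com_space B \<Longrightarrow> swap C A B (tvec C A B \<alpha> \<beta>) = tvec C B A \<beta> \<alpha>"
    by (simp_all add: swap_def lin_def)
qed

text \<open>Two nested inductions: the inner one splits the left factor, with additivity there
  coming from that of \<open>tvec\<close> in its first argument.\<close>

lemma triple_tensor_induct_left [consumes 4, case_names tvec add]:
  assumes obj: "A \<in> Obj C" "B \<in> Obj C" "D \<in> Obj C" and \<omega>: "\<omega> \<in> com_space ((A \<otimes> B) \<otimes> D)"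
    and tvec: "\<And>\<alpha> \<beta> \<delta>. \<alpha> \<in> com_space A \<Longrightarrow> \<beta> \<in> com_space B \<Longrightarrow> \<delta> \<in> com_space D \<Longrightarrow>
      P (tvec C (A \<otimes> B) D (tvec C A B \<alpha> \<beta>) \<delta>)"
    and add: "\<And>x y. x \<in> com_space ((A \<otimes> B) \<otimes> D) \<Longrightarrow> y \<in> com_space ((A \<otimes> B) \<otimes> D) \<Longrightarrow>
      P x \<Longrightarrow> P y \<Longrightarrow> P (x + y)"
  shows "P \<omega>"
  using tensor_Obj[OF obj(1,2)] obj(3) \<omega>
proof (induction rule: tensor_induct)
  case (tvec \<omega> \<delta>)
  from obj(1,2) tvec(1) show ?case
  proof (induction rule: tensor_induct)
    case (tvec \<alpha> \<beta>)
    with \<open>\<delta> \<in> com_space D\<close> assms(5) show ?case by blast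
  next
    case (add x y)
    with \<open>\<delta> \<in> com_space D\<close> obj show ?case
      by (simp add: tvec_add_left assms(6))
  qed
qed (rule add)

lemma triple_tensor_induct_right [consumes 4, case_names tvec add]:
  assumes obj: "A \<in> Obj C" "B \<in> Obj C" "D \<in> Obj C" and \<omega>: "\<omega> \<in> com_space (A \<otimes> (B \<otimes> D))"
    and tvec: "\<And>\<alpha> \<beta> \<delta>. \<alpha> \<in> com_space A \<Longrightarrow> \<beta> \<in> com_space B \<Longrightarrow> \<delta> \<in> com_space D \<Longrightarrow>
      P (tvec C A (B \<otimes> D) \<alpha> (tvec C B D \<beta> \<delta>))"
    and add: "\<And>x y. x \<in> com_space (A \<otimes> (B \<otimes> D)) \<Longrightarrow> y \<in> com_space (A \<otimes> (B \<otimes> D)) \<Longrightarrow>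
      P x \<Longrightarrow> P y \<Longrightarrow> P (x + y)"
  shows "P \<omega>"
  using obj(1) tensor_Obj[OF obj(2,3)] \<omega>
proof (induction rule: tensor_induct)
  case (tvec \<alpha> \<omega>)
  from obj(2,3) tvec(2) show ?case
  proof (induction rule: tensor_induct)
    case (tvec \<beta> \<delta>)
    with \<open>\<alpha> \<in> com_space A\<close> assms(5) show ?case by blast
  next
    case (add x y)
    with \<open>\<alpha> \<in> com_space A\<close> obj show ?case
      by (simp add: tvec_add_right assms(6))
  qed
qed (rule add)

text \<open>Existence applies the universal property twice, first for each fixed \<delta> on A
  \<otimes> B and then in the pair of a vector of A \<otimes> B and \<delta>. Uniqueness is
  induction over triple products.\<close>

lemma assoc_unique:
  assumes obj: "A \<in> Obj C" "B \<in> Obj C" "D \<in> Obj C"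
  shows "\<exists>!h. h \<in> lin ((A \<otimes> B) \<otimes> D) (A \<otimes> (B \<otimes> D)) \<and>
    (\<forall>\<alpha>\<in>com_space A. \<forall>\<beta>\<in>com_space B. \<forall>\<delta>\<in>com_space D.
      h (tvec C (A \<otimes> B) D (tvec C A B \<alpha> \<beta>) \<delta>) = tvec C A (B \<otimes> D) \<alpha> (tvec C B D \<beta> \<delta>))"
proof (rule ex_ex1I)
  let ?W = "com_space (A \<otimes> (B \<otimes> D))"
  note vec = tvec_add_left tvec_add_right tvec_scale_left tvec_scale_right
  have W: "subspace ?W" using obj by (simp add: subspace_Obj)
  have "\<exists>k. k \<in> lin_maps (com_space (A \<otimes> B)) ?W \<and>
      (\<forall>\<alpha>\<in>com_space A. \<forall>\<beta>\<in>com_space B. k (tvec C A B \<alpha> \<beta>) = tvec C A (B \<otimes> D) \<alpha> (tvec C B D \<beta> \<delta>))"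
    if "\<delta> \<in> com_space D" for \<delta>
    using that obj
    by (intro ex1_implies_ex[OF tensor_universal[OF obj(1,2) W]] bilinear_onI) (simp_all add: vec)
  then obtain k where k: "\<And>\<delta>. \<delta> \<in> com_space D \<Longrightarrow> k \<delta> \<in> lin_maps (com_space (A \<otimes> B)) ?W"
    and kt: "\<And>\<delta> \<alpha> \<beta>. \<delta> \<in> com_space D \<Longrightarrow> \<alpha> \<in> com_space A \<Longrightarrow> \<beta> \<in> com_space B \<Longrightarrow>
        k \<delta> (tvec C A B \<alpha> \<beta>) = tvec C A (B \<otimes> D) \<alpha> (tvec C B D \<beta> \<delta>)"
    by metis
  \<comment> \<open>Linearity in the vector of A \<otimes> B holds by the choice of
    \<open>k\<close>. Linearity in \<delta> has to be checked on product vectors, because each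
    \<open>k \<delta>\<close> was chosen separately.\<close>
  have "bilinear_on (com_space (A \<otimes> B)) (com_space D) ?W (\<lambda>\<omega> \<delta>. k \<delta> \<omega>)"
  proof (rule bilinear_onI)
    show "k (\<delta> + \<delta>') \<omega> = k \<delta> \<omega> + k \<delta>' \<omega>"
      if "\<omega> \<in> com_space (A \<otimes> B)" "\<delta> \<in> com_space D" "\<delta>' \<in> com_space D" for \<omega> \<delta> \<delta>'
      using obj(1,2) that(1)
      by (induction rule: tensor_induct)
        (use that(2,3) obj in \<open>simp_all add: kt vec lin_maps_add[OF k]\<close>)
    show "k (c *\<^sub>R \<delta>) \<omega> = c *\<^sub>R k \<delta> \<omega>"
      if "\<omega> \<in> com_space (A \<otimes> B)" "\<delta> \<in> com_space D" for c \<omega> \<delta>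
      using obj(1,2) that(1)
      by (induction rule: tensor_induct)
        (use that(2) obj in \<open>simp_all add: kt vec lin_maps_add[OF k] scaleR_add_right\<close>)
  qed (simp_all add: lin_maps_in[OF k] lin_maps_add[OF k] lin_maps_scale[OF k])
  from ex1_implies_ex[OF tensor_universal[OF tensor_Obj[OF obj(1,2)] obj(3) W this]]
  show "\<exists>h. h \<in> lin ((A \<otimes> B) \<otimes> D) (A \<otimes> (B \<otimes> D)) \<and>
    (\<forall>\<alpha>\<in>com_space A. \<forall>\<beta>\<in>com_space B. \<forall>\<delta>\<in>com_space D.
      h (tvec C (A \<otimes> B) D (tvec C A B \<alpha> \<beta>) \<delta>) = tvec C A (B \<otimes> D) \<alpha> (tvec C B D \<beta> \<delta>))"
    using obj by (auto simp: lin_def kt)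
next
  fix h k
  assume h: "h \<in> lin ((A \<otimes> B) \<otimes> D) (A \<otimes> (B \<otimes> D)) \<and>
    (\<forall>\<alpha>\<in>com_space A. \<forall>\<beta>\<in>com_space B. \<forall>\<delta>\<in>com_space D.
      h (tvec C (A \<otimes> B) D (tvec C A B \<alpha> \<beta>) \<delta>) = tvec C A (B \<otimes> D) \<alpha> (tvec C B D \<beta> \<delta>))"
  assume k: "k \<in> lin ((A \<otimes> B) \<otimes> D) (A \<otimes> (B \<otimes> D)) \<and>
    (\<forall>\<alpha>\<in>com_space A. \<forall>\<beta>\<in>com_space B. \<forall>\<delta>\<in>com_space D.
      k (tvec C (A \<otimes> B) D (tvec C A B \<alpha> \<beta>) \<delta>) = tvec C A (B \<otimes> D) \<alpha> (tvec C B D \<beta> \<delta>))"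
  show "h = k"
  proof (rule lin_eqI[OF h[THEN conjunct1] k[THEN conjunct1]])
    fix \<omega> assume "\<omega> \<in> com_space ((A \<otimes> B) \<otimes> D)"
    with obj show "h \<omega> = k \<omega>"
      by (induction rule: triple_tensor_induct_left)
        (simp_all add: h k lin_add[OF h[THEN conjunct1]] lin_add[OF k[THEN conjunct1]])
  qed
qed

lemma
  assumes "A \<in> Obj C" "B \<in> Obj C" "D \<in> Obj C"
  shows assoc_lin [simp]: "assoc C A B D \<in> lin ((A \<otimes> B) \<otimes> D) (A \<otimes> (B \<otimes> D))"
    and assoc_tvec [simp]: "\<alpha> \<in> com_space A \<Longrightarrow> \<beta> \<in> com_space B \<Longrightarrow> \<delta> \<in> com_space D \<Longrightarrow>
      assoc C A B D (tvec C (A \<otimes> B) D (tvec C A B \<alpha> \<beta>) \<delta>) = tvec C A (B \<otimes> D) \<alpha> (tvec C B D \<beta> \<delta>)"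
  using theI'[OF assoc_unique[OF assms]] by (simp_all add: assoc_def)

lemma
  assumes obj: "A \<in> Obj C" "B \<in> Obj C" "D \<in> Obj C"
  shows assoc_inv_lin [simp]: "assoc_inv C A B D \<in> lin (A \<otimes> (B \<otimes> D)) ((A \<otimes> B) \<otimes> D)"
    and assoc_inv_tvec [simp]: "\<alpha> \<in> com_space A \<Longrightarrow> \<beta> \<in> com_space B \<Longrightarrow> \<delta> \<in> com_space D \<Longrightarrow>
      assoc_inv C A B D (tvec C A (B \<otimes> D) \<alpha> (tvec C B D \<beta> \<delta>)) = tvec C (A \<otimes> B) D (tvec C A B \<alpha> \<beta>) \<delta>"
    and assoc_inv_assoc: "\<omega> \<in> com_space ((A \<otimes> B) \<otimes> D) \<Longrightarrow> assoc_inv C A B D (assoc C A B D \<omega>) = \<omega>"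
    and assoc_assoc_inv: "\<omega>' \<in> com_space (A \<otimes> (B \<otimes> D)) \<Longrightarrow> assoc C A B D (assoc_inv C A B D \<omega>') = \<omega>'"
proof -
  \<comment> \<open>The symmetries carry \<open>assoc C D B A\<close> to an inverse of \<open>assoc C A B D\<close>.\<close>
  define k where "k = tmap C (B \<otimes> A) (A \<otimes> B) D D (swap C B A) (idm D) \<circ> (swap C D (B \<otimes> A) \<circ>
    (assoc C D B A \<circ> (tmap C (B \<otimes> D) (D \<otimes> B) A A (swap C B D) (idm A) \<circ> swap C A (B \<otimes> D))))"
  have k: "k \<in> lin (A \<otimes> (B \<otimes> D)) ((A \<otimes> B) \<otimes> D)"
    unfolding k_def by (rule lin_comp swap_lin tmap_lin assoc_lin | simp add: obj)+
  have kt: "k (tvec C A (B \<otimes> D) \<alpha> (tvec C B D \<beta> \<delta>)) = tvec C (A \<otimes> B) D (tvec C A B \<alpha> \<beta>) \<delta>"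
    if "\<alpha> \<in> com_space A" "\<beta> \<in> com_space B" "\<delta> \<in> com_space D" for \<alpha> \<beta> \<delta>
    using that obj by (simp add: k_def)
  have ka: "k (assoc C A B D \<omega>) = \<omega>" if "\<omega> \<in> com_space ((A \<otimes> B) \<otimes> D)" for \<omega>
    using obj that
    by (induction rule: triple_tensor_induct_left)
      (use obj in \<open>simp_all add: kt lin_add[OF assoc_lin] lin_add[OF k] lin_in[OF assoc_lin]\<close>)
  have ak: "assoc C A B D (k \<omega>) = \<omega>" if "\<omega> \<in> com_space (A \<otimes> (B \<otimes> D))" for \<omega>
    using obj that
    by (induction rule: triple_tensor_induct_right)
      (use obj in \<open>simp_all add: kt lin_add[OF assoc_lin] lin_add[OF k] lin_in[OF k]\<close>)
  \<comment> \<open>This trades the inverse by choice for the explicit map, whose linearity and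
    values are known.\<close>
  have "assoc_inv C A B D = k"
    unfolding assoc_inv_def invm_def
    by (rule inv_map_eqI) (use assoc_lin[OF obj] k ka ak in \<open>simp_all add: lin_def\<close>)
  then show "assoc_inv C A B D \<in> lin (A \<otimes> (B \<otimes> D)) ((A \<otimes> B) \<otimes> D)"
    "\<alpha> \<in> com_space A \<Longrightarrow> \<beta> \<in> com_space B \<Longrightarrow> \<delta> \<in> com_space D \<Longrightarrow>
      assoc_inv C A B D (tvec C A (B \<otimes> D) \<alpha> (tvec C B D \<beta> \<delta>)) = tvec C (A \<otimes> B) D (tvec C A B \<alpha> \<beta>) \<delta>"
    "\<omega> \<in> com_space ((A \<otimes> B) \<otimes> D) \<Longrightarrow> assoc_inv C A B D (assoc C A B D \<omega>) = \<omega>"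
    "\<omega>' \<in> com_space (A \<otimes> (B \<otimes> D)) \<Longrightarrow> assoc C A B D (assoc_inv C A B D \<omega>') = \<omega>'"
    using k kt ka ak by simp_all
qed

section \<open>The unit object and the unit isomorphisms\<close>

lemma com_space_I: "com_space \<I> = span {one_vec C}"
  by (simp add: I_ob_def line_com_def)

lemma one_vec_in [simp]: "one_vec C \<in> com_space \<I>"
  by (simp add: com_space_I span_base)

lemma com_unit_I_lin_maps: "com_unit \<I> \<in> lin_maps (com_space \<I>) UNIV"
  using Obj_is_com[OF I_Obj] by (simp add: is_com_def dual_space_def)

lemma com_unit_one_vec [simp]: "com_unit \<I> (one_vec C) = 1"
proof -
  have "one_vec C = 1 *\<^sub>R one_vec C \<and> (\<forall>t. one_vec C = t *\<^sub>R one_vec C \<longrightarrow> t = 1)"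
    using one_vec_nonzero by (metis scaleR_cancel_right scaleR_one)
  then have "(THE t. one_vec C = t *\<^sub>R one_vec C) = 1"
    by (intro the_equality) auto
  then show ?thesis
    by (simp add: I_ob_def line_com_def line_coord_def span_base)
qed

lemma com_unit_add: "x \<in> com_space \<I> \<Longrightarrow> y \<in> com_space \<I> \<Longrightarrow> com_unit \<I> (x + y) = com_unit \<I> x + com_unit \<I> y"
  by (rule lin_maps_add[OF com_unit_I_lin_maps])

lemma com_unit_scale [simp]: "x \<in> com_space \<I> \<Longrightarrow> com_unit \<I> (c *\<^sub>R x) = c * com_unit \<I> x"
  using lin_maps_scale[OF com_unit_I_lin_maps, of x c] by simp

text \<open>Since I is a line, this rewrites any vector of I as a multiple of
  \<open>one_vec C\<close> and so reduces statements about I to that vector.\<close>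

lemma com_unit_scale_one:
  assumes "x \<in> com_space \<I>"
  shows "com_unit \<I> x *\<^sub>R one_vec C = x"
proof -
  obtain c where "x = c *\<^sub>R one_vec C"
    using assms by (auto simp: com_space_I span_singleton)
  then show ?thesis by simp
qed

lemma lunit_unique:
  assumes "A \<in> Obj C"
  shows "\<exists>!h. h \<in> lin (\<I> \<otimes> A) A \<and> (\<forall>\<alpha>\<in>com_space A. h (tvec C \<I> A (one_vec C) \<alpha>) = \<alpha>)"
proof -
  \<comment> \<open>The definition prescribes values only at \<open>one_vec C\<close>, whereas the
    universal property wants them at all vectors of I. For linear maps the two conditions
    agree.\<close>
  have eq: "(\<forall>\<alpha>\<in>com_space A. h (tvec C \<I> A (one_vec C) \<alpha>) = \<alpha>) \<longleftrightarrow>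
      (\<forall>x\<in>com_space \<I>. \<forall>\<alpha>\<in>com_space A. h (tvec C \<I> A x \<alpha>) = com_unit \<I> x *\<^sub>R \<alpha>)"
    if "h \<in> lin (\<I> \<otimes> A) A" for h
  proof safe
    fix x \<alpha> assume *: "\<forall>\<alpha>\<in>com_space A. h (tvec C \<I> A (one_vec C) \<alpha>) = \<alpha>"
      and x: "x \<in> com_space \<I>" and \<alpha>: "\<alpha> \<in> com_space A"
    have "h (tvec C \<I> A (com_unit \<I> x *\<^sub>R one_vec C) \<alpha>) = com_unit \<I> x *\<^sub>R \<alpha>"
      using assms \<alpha> * by (simp add: tvec_scale_left lin_scale[OF that])
    then show "h (tvec C \<I> A x \<alpha>) = com_unit \<I> x *\<^sub>R \<alpha>"
      by (simp add: com_unit_scale_one[OF x])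
  qed simp
  have "bilinear_on (com_space \<I>) (com_space A) (com_space A) (\<lambda>x \<alpha>. com_unit \<I> x *\<^sub>R \<alpha>)"
    using assms
    by (intro bilinear_onI) (simp_all add: com_unit_add scaleR_add_left scaleR_add_right)
  from tensor_universal[OF I_Obj assms subspace_Obj[OF assms] this] show ?thesis
    unfolding lin_def[symmetric] using eq by (auto cong: conj_cong)
qed

lemma
  assumes A: "A \<in> Obj C"
  shows lunit_lin [simp]: "lunit C A \<in> lin (\<I> \<otimes> A) A"
    and lunit_tvec_one: "\<alpha> \<in> com_space A \<Longrightarrow> lunit C A (tvec C \<I> A (one_vec C) \<alpha>) = \<alpha>"
  using theI'[OF lunit_unique[OF A]] by (simp_all add: lunit_def)

lemma lunit_tvec [simp]:
  assumes A: "A \<in> Obj C" and x: "x \<in> com_space \<I>" and \<alpha>: "\<alpha> \<in> com_space A"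
  shows "lunit C A (tvec C \<I> A x \<alpha>) = com_unit \<I> x *\<^sub>R \<alpha>"
proof -
  have "lunit C A (tvec C \<I> A (com_unit \<I> x *\<^sub>R one_vec C) \<alpha>) = com_unit \<I> x *\<^sub>R \<alpha>"
    using A \<alpha> by (simp add: tvec_scale_left tvec_scale_right lin_scale[OF lunit_lin] lunit_tvec_one)
  then show ?thesis by (simp add: com_unit_scale_one[OF x])
qed

lemma
  assumes A: "A \<in> Obj C"
  shows lunit_inv_lin [simp]: "lunit_inv C A \<in> lin A (\<I> \<otimes> A)"
    and lunit_inv_apply [simp]: "\<alpha> \<in> com_space A \<Longrightarrow> lunit_inv C A \<alpha> = tvec C \<I> A (one_vec C) \<alpha>"
    and lunit_inv_lunit: "\<omega> \<in> com_space (\<I> \<otimes> A) \<Longrightarrow> lunit_inv C A (lunit C A \<omega>) = \<omega>"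
proof -
  define k where "k \<alpha> = (if \<alpha> \<in> com_space A then tvec C \<I> A (one_vec C) \<alpha> else 0)" for \<alpha>
  have k: "k \<in> lin A (\<I> \<otimes> A)"
    unfolding lin_def using A
    by (intro lin_mapsI) (simp_all add: k_def tvec_add_left tvec_add_right tvec_scale_left tvec_scale_right)
  have kl: "k (lunit C A \<omega>) = \<omega>" if "\<omega> \<in> com_space (\<I> \<otimes> A)" for \<omega>
    using I_Obj A that
  proof (induction rule: tensor_induct)
    case (tvec x \<alpha>)
    \<comment> \<open>The scalar \<open>com_unit \<I> x\<close> is moved from \<alpha> to
      \<open>one_vec C\<close>, where it restores x.\<close>
    then show ?case
      using A by (simp add: k_def tvec_scale_right
        flip: tvec_scale_left)
        (simp add: com_unit_scale_one)
  next
    case (add x y)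
    then show ?case
      using A by (simp add: lin_add[OF k] lin_add[OF lunit_lin] lin_in[OF lunit_lin])
  qed
  have "lunit_inv C A = k"
    unfolding lunit_inv_def invm_def
    by (rule inv_map_eqI) (use A lunit_lin[OF A] k kl in \<open>simp_all add: lin_def k_def\<close>)
  then show "lunit_inv C A \<in> lin A (\<I> \<otimes> A)"
    "\<alpha> \<in> com_space A \<Longrightarrow> lunit_inv C A \<alpha> = tvec C \<I> A (one_vec C) \<alpha>"
    "\<omega> \<in> com_space (\<I> \<otimes> A) \<Longrightarrow> lunit_inv C A (lunit C A \<omega>) = \<omega>"
    using k kl by (simp_all add: k_def)
qed

lemma runit_unique:
  assumes "A \<in> Obj C"
  shows "\<exists>!h. h \<in> lin (A \<otimes> \<I>) A \<and> (\<forall>\<alpha>\<in>com_space A. h (tvec C A \<I> \<alpha> (one_vec C)) = \<alpha>)"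
proof -
  have eq: "(\<forall>\<alpha>\<in>com_space A. h (tvec C A \<I> \<alpha> (one_vec C)) = \<alpha>) \<longleftrightarrow>
      (\<forall>\<alpha>\<in>com_space A. \<forall>x\<in>com_space \<I>. h (tvec C A \<I> \<alpha> x) = com_unit \<I> x *\<^sub>R \<alpha>)"
    if "h \<in> lin (A \<otimes> \<I>) A" for h
  proof safe
    fix x \<alpha> assume *: "\<forall>\<alpha>\<in>com_space A. h (tvec C A \<I> \<alpha> (one_vec C)) = \<alpha>"
      and x: "x \<in> com_space \<I>" and \<alpha>: "\<alpha> \<in> com_space A"
    have "h (tvec C A \<I> \<alpha> (com_unit \<I> x *\<^sub>R one_vec C)) = com_unit \<I> x *\<^sub>R \<alpha>"
      using assms \<alpha> * by (simp add: tvec_scale_right lin_scale[OF that])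
    then show "h (tvec C A \<I> \<alpha> x) = com_unit \<I> x *\<^sub>R \<alpha>"
      by (simp add: com_unit_scale_one[OF x])
  qed simp
  have "bilinear_on (com_space A) (com_space \<I>) (com_space A) (\<lambda>\<alpha> x. com_unit \<I> x *\<^sub>R \<alpha>)"
    using assms
    by (intro bilinear_onI) (simp_all add: com_unit_add scaleR_add_left scaleR_add_right)
  from tensor_universal[OF assms I_Obj subspace_Obj[OF assms] this] show ?thesis
    unfolding lin_def[symmetric] using eq by (auto cong: conj_cong)
qed

lemma
  assumes A: "A \<in> Obj C"
  shows runit_lin [simp]: "runit C A \<in> lin (A \<otimes> \<I>) A"
    and runit_tvec_one: "\<alpha> \<in> com_space A \<Longrightarrow> runit C A (tvec C A \<I> \<alpha> (one_vec C)) = \<alpha>"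
  using theI'[OF runit_unique[OF A]] by (simp_all add: runit_def)

lemma runit_tvec [simp]:
  assumes A: "A \<in> Obj C" and x: "x \<in> com_space \<I>" and \<alpha>: "\<alpha> \<in> com_space A"
  shows "runit C A (tvec C A \<I> \<alpha> x) = com_unit \<I> x *\<^sub>R \<alpha>"
proof -
  have "runit C A (tvec C A \<I> \<alpha> (com_unit \<I> x *\<^sub>R one_vec C)) = com_unit \<I> x *\<^sub>R \<alpha>"
    using A \<alpha> by (simp add: tvec_scale_left tvec_scale_right lin_scale[OF runit_lin] runit_tvec_one)
  then show ?thesis by (simp add: com_unit_scale_one[OF x])
qed

lemma
  assumes A: "A \<in> Obj C"
  shows runit_inv_lin [simp]: "runit_inv C A \<in> lin A (A \<otimes> \<I>)"
    and runit_inv_apply [simp]: "\<alpha> \<in> com_space A \<Longrightarrow> runit_inv C A \<alpha> = tvec C A \<I> \<alpha> (one_vec C)"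
    and runit_inv_runit: "\<omega> \<in> com_space (A \<otimes> \<I>) \<Longrightarrow> runit_inv C A (runit C A \<omega>) = \<omega>"
proof -
  define k where "k \<alpha> = (if \<alpha> \<in> com_space A then tvec C A \<I> \<alpha> (one_vec C) else 0)" for \<alpha>
  have k: "k \<in> lin A (A \<otimes> \<I>)"
    unfolding lin_def using A
    by (intro lin_mapsI) (simp_all add: k_def tvec_add_left tvec_add_right tvec_scale_left tvec_scale_right)
  have kl: "k (runit C A \<omega>) = \<omega>" if "\<omega> \<in> com_space (A \<otimes> \<I>)" for \<omega>
    using A I_Obj that
  proof (induction rule: tensor_induct)
    case (tvec \<alpha> x)
    then show ?case
      using A by (simp add: k_def tvec_scale_left
        flip: tvec_scale_right)
        (simp add: com_unit_scale_one)
  next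
    case (add x y)
    then show ?case
      using A by (simp add: lin_add[OF k] lin_add[OF runit_lin] lin_in[OF runit_lin])
  qed
  have "runit_inv C A = k"
    unfolding runit_inv_def invm_def
    by (rule inv_map_eqI) (use A runit_lin[OF A] k kl in \<open>simp_all add: lin_def k_def\<close>)
  then show "runit_inv C A \<in> lin A (A \<otimes> \<I>)"
    "\<alpha> \<in> com_space A \<Longrightarrow> runit_inv C A \<alpha> = tvec C A \<I> \<alpha> (one_vec C)"
    "\<omega> \<in> com_space (A \<otimes> \<I>) \<Longrightarrow> runit_inv C A (runit C A \<omega>) = \<omega>"
    using k kl by (simp_all add: k_def)
qed

section \<open>Morphisms of the category, the middle swap and partial evaluation\<close>

lemma tmap_Hom:
  assumes "\<phi> \<in> Hom C A A'" "\<psi> \<in> Hom C B B'" "A \<in> Obj C" "A' \<in> Obj C" "B \<in> Obj C" "B' \<in> Obj C"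
  shows "tmap C A A' B B' \<phi> \<psi> \<in> Hom C (A \<otimes> B) (A' \<otimes> B')"
proof -
  have "\<forall>A\<in>Obj C. \<forall>A'\<in>Obj C. \<forall>B\<in>Obj C. \<forall>B'\<in>Obj C. \<forall>\<phi>\<in>Hom C A A'. \<forall>\<psi>\<in>Hom C B B'.
      tmap C A A' B B' \<phi> \<psi> \<in> Hom C (A \<otimes> B) (A' \<otimes> B')"
    using monoidal by (simp add: monoidal_category_of_coms_def)
  from this[rule_format, OF assms(3-6,1,2)] show ?thesis .
qed

lemma assoc_Hom:
  "A \<in> Obj C \<Longrightarrow> B \<in> Obj C \<Longrightarrow> D \<in> Obj C \<Longrightarrow> assoc C A B D \<in> Hom C ((A \<otimes> B) \<otimes> D) (A \<otimes> (B \<otimes> D))"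
  using monoidal by (simp add: monoidal_category_of_coms_def)

lemma lunit_inv_Hom: "A \<in> Obj C \<Longrightarrow> lunit_inv C A \<in> Hom C A (\<I> \<otimes> A)"
  using monoidal by (simp add: monoidal_category_of_coms_def)

lemma runit_Hom: "A \<in> Obj C \<Longrightarrow> runit C A \<in> Hom C (A \<otimes> \<I>) A"
  using monoidal by (simp add: monoidal_category_of_coms_def)

text \<open>This holds at every x: outside the domain \<phi> x is 0, which \<open>idm B\<close>
  fixes.\<close>

lemma idm_comp:
  assumes "\<phi> \<in> lin A B" "B \<in> Obj C"
  shows "idm B (\<phi> x) = \<phi> x"
  using assms by (cases "x \<in> com_space A") (simp_all add: lin_in lin_outside)

lemma tmap_idm:
  assumes "A \<in> Obj C" "B \<in> Obj C"
  shows "tmap C A A B B (idm A) (idm B) = idm (A \<otimes> B)"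
  by (rule tensor_eqI[OF assms, where W="com_space (A \<otimes> B)" and W'="com_space (A \<otimes> B)", folded lin_def])
    (simp_all add: assms)

lemma swap_swap:
  assumes "A \<in> Obj C" "B \<in> Obj C" "\<omega> \<in> com_space (A \<otimes> B)"
  shows "swap C B A (swap C A B \<omega>) = \<omega>"
  using assms
  by (induction rule: tensor_induct)
    (use assms(1,2) in \<open>simp_all add: lin_add[OF swap_lin] lin_in[OF swap_lin]\<close>)

lemma middle_swap_tvec [simp]:
  assumes "A \<in> Obj C" "B \<in> Obj C" "D \<in> Obj C" "E \<in> Obj C"
    and "\<alpha> \<in> com_space A" "\<beta> \<in> com_space B" "\<delta> \<in> com_space D" "\<epsilon> \<in> com_space E"
  shows "middle_swap C A B D E (tvec C (A \<otimes> B) (D \<otimes> E) (tvec C A B \<alpha> \<beta>) (tvec C D E \<delta> \<epsilon>)) =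
    tvec C (A \<otimes> D) (B \<otimes> E) (tvec C A D \<alpha> \<delta>) (tvec C B E \<beta> \<epsilon>)"
proof -
  \<comment> \<open>\<open>tmap_tvec\<close> applies to the outer tensor product only once its inner
    factor is known to be linear.\<close>
  have "assoc C D B E \<circ> (tmap C (B \<otimes> D) (D \<otimes> B) E E (swap C B D) (idm E) \<circ> assoc_inv C B D E)
      \<in> lin (B \<otimes> (D \<otimes> E)) (D \<otimes> (B \<otimes> E))"
    by (rule lin_comp swap_lin tmap_lin assoc_lin assoc_inv_lin | simp add: assms)+
  then show ?thesis
    using assms by (simp add: middle_swap_def o_assoc)
qed

lemma effect_map_lin [simp]: "a \<in> com_dual A \<Longrightarrow> effect_map C a \<in> lin A \<I>"
  unfolding lin_def effect_map_def
  by (rule lin_mapsI)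
    (simp_all add: dual_space_add dual_space_scale scaleR_add_left,
     simp add: dual_space_def lin_maps_outside)

text \<open>The part of \<open>state_hat\<close> that comes after the state. It is linear in the
  vector of A \<otimes> B, so identities about a particular state can be generalised to all vectors
  and proved by \<open>tensor_induct\<close>.\<close>

definition contract :: "'v com \<Rightarrow> 'v com \<Rightarrow> ('v \<Rightarrow> real) \<Rightarrow> 'v \<Rightarrow> 'v" where
  "contract A B a = lunit C B \<circ> tmap C A \<I> B B (effect_map C a) (idm B)"

lemma
  assumes "A \<in> Obj C" "B \<in> Obj C" "a \<in> com_dual A"
  shows contract_lin [simp]: "contract A B a \<in> lin (A \<otimes> B) B"
    and contract_tvec [simp]: "\<alpha> \<in> com_space A \<Longrightarrow> \<beta> \<in> com_space B \<Longrightarrow>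
      contract A B a (tvec C A B \<alpha> \<beta>) = a \<alpha> *\<^sub>R \<beta>"
proof -
  show "contract A B a \<in> lin (A \<otimes> B) B"
    unfolding contract_def by (rule lin_comp tmap_lin lunit_lin | simp add: assms)+
  show "contract A B a (tvec C A B \<alpha> \<beta>) = a \<alpha> *\<^sub>R \<beta>" if "\<alpha> \<in> com_space A" "\<beta> \<in> com_space B"
    using assms that by (simp add: contract_def lin_in[OF effect_map_lin]) (simp add: effect_map_def)
qed

lemma state_hat_contract: "state_hat C A B \<gamma> a = contract A B a (\<gamma> (one_vec C))"
  by (simp add: state_hat_def contract_def)

end

section \<open>The pairings of a choice of self-dualities and the canonical adjoint\<close>

locale self_dual_coms = monoidal_coms C
  for C :: "'v::real_normed_vector com_category" (structure) +
  fixes \<gamma> f :: "'v com \<Rightarrow> 'v \<Rightarrow> 'v"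
  assumes choice: "self_duality_choice C \<gamma> f"
begin

lemma implements: "A \<in> Obj C \<Longrightarrow> implements_self_duality C A (\<gamma> A) (f A)"
  using choice by (simp add: self_duality_choice_def)

lemma
  assumes "A \<in> Obj C"
  shows \<gamma>_Hom: "\<gamma> A \<in> Hom C \<I> (A \<otimes> A)" and f_Hom: "f A \<in> Hom C (A \<otimes> A) \<I>"
    and \<gamma>_lin [simp]: "\<gamma> A \<in> lin \<I> (A \<otimes> A)" and f_lin [simp]: "f A \<in> lin (A \<otimes> A) \<I>"
  using implements[OF assms] assms by (auto simp: implements_self_duality_def intro!: Hom_lin)

definition pairing :: "'v com \<Rightarrow> 'v \<Rightarrow> 'v \<Rightarrow> real" where
  "pairing A x y = com_unit \<I> (f A (tvec C A A x y))"

lemma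
  assumes "A \<in> Obj C" "x \<in> com_space A" "y \<in> com_space A"
  shows pairing_add_left: "x' \<in> com_space A \<Longrightarrow> pairing A (x + x') y = pairing A x y + pairing A x' y"
    and pairing_add_right: "y' \<in> com_space A \<Longrightarrow> pairing A x (y + y') = pairing A x y + pairing A x y'"
    and pairing_scale_left: "pairing A (c *\<^sub>R x) y = c * pairing A x y"
    and pairing_scale_right: "pairing A x (c *\<^sub>R y) = c * pairing A x y"
  using assms
  by (simp_all add: pairing_def tvec_add_left tvec_add_right tvec_scale_left tvec_scale_right
      lin_add[OF f_lin] lin_scale[OF f_lin] lin_in[OF f_lin] com_unit_add)

abbreviation flat :: "'v com \<Rightarrow> 'v \<Rightarrow> 'v \<Rightarrow> real" where
  "flat A x \<equiv> effect_hat C A A (f A) x"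

lemma flat_apply: "y \<in> com_space A \<Longrightarrow> flat A x y = pairing A x y"
  by (simp add: effect_hat_def pairing_def)

lemma flat_com_dual: "A \<in> Obj C \<Longrightarrow> x \<in> com_space A \<Longrightarrow> flat A x \<in> com_dual A"
  unfolding dual_space_def
  by (rule lin_mapsI)
    (simp_all add: flat_apply pairing_add_right pairing_scale_right, simp add: effect_hat_def)

text \<open>By \<open>state_hat_contract\<close> this is \<open>state_hat\<close> of \<gamma>, hence
  inverse to \<open>flat\<close> by the choice of the pair.\<close>

abbreviation sharp :: "'v com \<Rightarrow> ('v \<Rightarrow> real) \<Rightarrow> 'v" where
  "sharp A a \<equiv> contract A A a (\<gamma> A (one_vec C))"

lemma \<gamma>_in [simp]: "A \<in> Obj C \<Longrightarrow> \<gamma> A (one_vec C) \<in> com_space (A \<otimes> A)"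
  by (rule lin_in[OF \<gamma>_lin]) simp_all

lemma sharp_in: "A \<in> Obj C \<Longrightarrow> a \<in> com_dual A \<Longrightarrow> sharp A a \<in> com_space A"
  by (rule lin_in[OF contract_lin]) simp_all

lemma sharp_flat: "A \<in> Obj C \<Longrightarrow> x \<in> com_space A \<Longrightarrow> sharp A (flat A x) = x"
  using implements[of A] by (simp add: implements_self_duality_def state_hat_contract)

lemma pairing_sharp:
  assumes "A \<in> Obj C" "a \<in> com_dual A" "x \<in> com_space A"
  shows "pairing A (sharp A a) x = a x"
proof -
  have "flat A (sharp A a) = a"
    using implements[of A] assms by (simp add: implements_self_duality_def state_hat_contract)
  then show ?thesis
    using flat_apply[OF assms(3), of "sharp A a"] by simp
qed

text \<open>Every functional is the pairing with some vector on the left, namely its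
  \<open>sharp\<close>, and functionals separate points.\<close>

lemma pairing_nondegenerate:
  assumes "A \<in> Obj C" "x \<in> com_space A" "y \<in> com_space A"
    and "\<And>z. z \<in> com_space A \<Longrightarrow> pairing A z x = pairing A z y"
  shows "x = y"
proof (rule com_dual_separates[OF Obj_is_com[OF assms(1)] assms(2,3)])
  fix a assume "a \<in> com_dual A"
  then show "a x = a y"
    using assms pairing_sharp[OF assms(1), of a] sharp_in[OF assms(1), of a] by metis
qed

section \<open>The canonical adjoint as the adjoint for the pairings\<close>

abbreviation adj :: "'v dagger" where
  "adj \<equiv> canonical_adjoint C \<gamma> f"

lemma adj_Hom:
  assumes "\<phi> \<in> Hom C A B" "A \<in> Obj C" "B \<in> Obj C"
  shows "adj A B \<phi> \<in> Hom C B A"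
  unfolding canonical_adjoint_def
  by (rule Hom_comp tmap_Hom assoc_Hom lunit_inv_Hom runit_Hom idm_Hom \<gamma>_Hom f_Hom assms
      | simp add: assms)+

text \<open>The adjoint calculus below is linear algebra, so it is developed for all linear maps and
  not just for morphisms.\<close>

lemma adj_lin:
  assumes "\<phi> \<in> lin A B" "A \<in> Obj C" "B \<in> Obj C"
  shows "adj A B \<phi> \<in> lin B A"
  unfolding canonical_adjoint_def
  by (rule lin_comp tmap_lin assoc_lin lunit_inv_lin runit_lin idm_lin \<gamma>_lin f_lin assms
      | simp add: assms)+

text \<open>Replace the vector of \<gamma> by an arbitrary \<omega>. At \<omega> = \<alpha>
  \<otimes> \<beta> the remaining maps give <\<phi> \<beta>, y> \<alpha>, whose pairing with x is
  <x, \<alpha>> <\<phi> \<beta>, y>. Returning to \<gamma>, the contraction with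
  \<open>flat A x\<close> is x by \<open>sharp_flat\<close>.\<close>

lemma pairing_adj:
  assumes \<phi>: "\<phi> \<in> lin A B" and A: "A \<in> Obj C" and B: "B \<in> Obj C"
    and x: "x \<in> com_space A" and y: "y \<in> com_space B"
  shows "pairing A x (adj A B \<phi> y) = pairing B (\<phi> x) y"
proof -
  \<comment> \<open>All of the canonical adjoint that follows the insertion of \<gamma>.\<close>
  define M where "M = runit C A \<circ> (tmap C A A (B \<otimes> B) \<I> (idm A) (f B) \<circ>
    (tmap C A A (A \<otimes> B) (B \<otimes> B) (idm A) (tmap C A B B B \<phi> (idm B)) \<circ> assoc C A A B))"
  have M: "M \<in> lin ((A \<otimes> A) \<otimes> B) A"
    unfolding M_def
    by (rule lin_comp tmap_lin assoc_lin runit_lin idm_lin f_lin assms | simp add: A B)+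
  have a: "flat A x \<in> com_dual A" by (rule flat_com_dual[OF A x])
  have "flat A x (M (tvec C (A \<otimes> A) B \<omega> y)) = pairing B (\<phi> (contract A A (flat A x) \<omega>)) y"
    if "\<omega> \<in> com_space (A \<otimes> A)" for \<omega>
    using A A that
  proof (induction rule: tensor_induct)
    case (tvec \<alpha> \<beta>)
    have "M (tvec C (A \<otimes> A) B (tvec C A A \<alpha> \<beta>) y) = pairing B (\<phi> \<beta>) y *\<^sub>R \<alpha>"
      using tvec A B y \<phi>
      by (simp add: M_def pairing_def lin_in[OF \<phi>] lin_in[OF f_lin])
    then show ?case
      using tvec A B y a \<phi>
      by (simp add: dual_space_scale[OF a] lin_scale[OF \<phi>] pairing_scale_left lin_in[OF \<phi>])
  next
    case (add \<omega> \<omega>')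
    then show ?case
      using A B y a
      by (simp add: tvec_add_left lin_add[OF M] lin_in[OF M] dual_space_add[OF a]
          lin_add[OF contract_lin] lin_in[OF contract_lin] lin_add[OF \<phi>] lin_in[OF \<phi>] pairing_add_left)
  qed
  from this[of "\<gamma> A (one_vec C)"]
  have "flat A x (M (tvec C (A \<otimes> A) B (\<gamma> A (one_vec C)) y)) = pairing B (\<phi> x) y"
    using A x by (simp add: sharp_flat)
  moreover have "adj A B \<phi> y = M (tvec C (A \<otimes> A) B (\<gamma> A (one_vec C)) y)"
    using A B y by (simp add: canonical_adjoint_def M_def)
  ultimately show ?thesis
    using lin_in[OF adj_lin[OF \<phi> A B] y] by (simp add: flat_apply)
qed

text \<open>Nondegeneracy makes the adjoint the only solution of the equation in
  \<open>pairing_adj\<close>, so an adjoint is computed by guessing it and checking one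
  identity.\<close>

lemma adj_eqI:
  assumes \<phi>: "\<phi> \<in> lin A B" and \<psi>: "\<psi> \<in> lin B A" and A: "A \<in> Obj C" and B: "B \<in> Obj C"
    and eq: "\<And>x y. x \<in> com_space A \<Longrightarrow> y \<in> com_space B \<Longrightarrow> pairing A x (\<psi> y) = pairing B (\<phi> x) y"
  shows "adj A B \<phi> = \<psi>"
proof (rule lin_eqI[OF adj_lin[OF \<phi> A B] \<psi>])
  fix y assume y: "y \<in> com_space B"
  show "adj A B \<phi> y = \<psi> y"
    using pairing_adj[OF \<phi> A B _ y] eq[OF _ y]
    by (intro pairing_nondegenerate[OF A lin_in[OF adj_lin[OF \<phi> A B] y] lin_in[OF \<psi> y]]) simp
qed

lemma adj_idm: "A \<in> Obj C \<Longrightarrow> adj A A (idm A) = idm A"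
  by (rule adj_eqI) simp_all

lemma adj_comp:
  assumes \<phi>: "\<phi> \<in> lin A B" and \<psi>: "\<psi> \<in> lin B D" and obj: "A \<in> Obj C" "B \<in> Obj C" "D \<in> Obj C"
  shows "adj A D (\<psi> \<circ> \<phi>) = adj A B \<phi> \<circ> adj B D \<psi>"
proof (rule adj_eqI[OF lin_comp[OF \<phi> \<psi>] lin_comp[OF adj_lin[OF \<psi>] adj_lin[OF \<phi>]]])
  fix x y assume "x \<in> com_space A" "y \<in> com_space D"
  then show "pairing A x ((adj A B \<phi> \<circ> adj B D \<psi>) y) = pairing D ((\<psi> \<circ> \<phi>) x) y"
    using obj \<phi> \<psi> by (simp add: pairing_adj lin_in[OF adj_lin[OF \<psi>]] lin_in[OF \<phi>])
qed (use obj in simp_all)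

section \<open>Multiplicativity of the pairings, and unitarity of the structural
  isomorphisms\<close>

lemma pairing_I:
  assumes "x \<in> com_space \<I>" "y \<in> com_space \<I>"
  shows "pairing \<I> x y = com_unit \<I> x * com_unit \<I> y"
proof -
  have "f \<I> = lunit C \<I>"
    using choice by (simp add: self_duality_choice_def)
  with assms show ?thesis by (simp add: pairing_def)
qed

text \<open>This is where the compatibility of the choice with tensor products enters: the middle
  swap brings \<alpha> next to \<alpha>' and \<beta> next to \<beta>'.\<close>

lemma pairing_tvec [simp]:
  assumes obj: "A \<in> Obj C" "B \<in> Obj C"
    and "\<alpha> \<in> com_space A" "\<alpha>' \<in> com_space A" "\<beta> \<in> com_space B" "\<beta>' \<in> com_space B"
  shows "pairing (A \<otimes> B) (tvec C A B \<alpha> \<beta>) (tvec C A B \<alpha>' \<beta>') = pairing A \<alpha> \<alpha>' * pairing B \<beta> \<beta>'"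
proof -
  have "f (A \<otimes> B) = lunit C \<I> \<circ> tmap C (A \<otimes> A) \<I> (B \<otimes> B) \<I> (f A) (f B) \<circ> middle_swap C A B A B"
    using choice obj by (simp add: self_duality_choice_def)
  with assms show ?thesis
    by (simp add: pairing_def lin_in[OF f_lin])
qed

text \<open>On product vectors both sides of the criterion \<open>adj_eqI\<close> factor into the
  adjoint equations of \<phi> and \<psi>; two inductions extend this to all vectors.\<close>

lemma adj_tmap:
  assumes \<phi>: "\<phi> \<in> lin A A'" and \<psi>: "\<psi> \<in> lin B B'"
    and obj: "A \<in> Obj C" "A' \<in> Obj C" "B \<in> Obj C" "B' \<in> Obj C"
  shows "adj (A \<otimes> B) (A' \<otimes> B') (tmap C A A' B B' \<phi> \<psi>) =
    tmap C A' A B' B (adj A A' \<phi>) (adj B B' \<psi>)" (is "_ = ?\<chi>")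
proof -
  let ?\<tau> = "tmap C A A' B B' \<phi> \<psi>"
  note \<phi>' = adj_lin[OF \<phi> obj(1,2)] and \<psi>' = adj_lin[OF \<psi> obj(3,4)]
  have \<tau>: "?\<tau> \<in> lin (A \<otimes> B) (A' \<otimes> B')" and \<chi>: "?\<chi> \<in> lin (A' \<otimes> B') (A \<otimes> B)"
    using \<phi> \<psi> \<phi>' \<psi>' obj by simp_all
  show ?thesis
  proof (rule adj_eqI[OF \<tau> \<chi>])
    fix x y assume x: "x \<in> com_space (A \<otimes> B)" and y: "y \<in> com_space (A' \<otimes> B')"
    from obj(1,3) x show "pairing (A \<otimes> B) x (?\<chi> y) = pairing (A' \<otimes> B') (?\<tau> x) y"
    proof (induction rule: tensor_induct)
      case (tvec \<alpha> \<beta>)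
      from obj(2,4) y show ?case
      proof (induction rule: tensor_induct)
        case (tvec \<alpha>' \<beta>')
        then show ?case
          using \<open>\<alpha> \<in> com_space A\<close> \<open>\<beta> \<in> com_space B\<close> obj \<phi> \<psi> \<phi>' \<psi>'
          by (simp add: lin_in[OF \<phi>] lin_in[OF \<psi>] lin_in[OF \<phi>'] lin_in[OF \<psi>'] pairing_adj)
      next
        case (add u v)
        then show ?case
          using \<open>\<alpha> \<in> com_space A\<close> \<open>\<beta> \<in> com_space B\<close> obj
          by (simp add: lin_add[OF \<chi>] lin_in[OF \<chi>] lin_in[OF \<tau>] pairing_add_right
              del: tmap_tvec)
      qed
    next
      case (add u v)
      then show ?case
        using y obj by (simp add: lin_add[OF \<tau>] lin_in[OF \<chi>] lin_in[OF \<tau>] pairing_add_left)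
    qed
  qed (use obj in simp_all)
qed

text \<open>For an invertible isometry <x, \<psi> y> = <\<phi> x, \<phi> (\<psi> y)> = <\<phi> x,
  y>, so the inverse \<psi> satisfies the criterion for the adjoint.\<close>

lemma isometry_unitary:
  assumes \<phi>: "\<phi> \<in> lin A B" and \<psi>: "\<psi> \<in> lin B A" and A: "A \<in> Obj C" and B: "B \<in> Obj C"
    and \<psi>\<phi>: "\<And>x. x \<in> com_space A \<Longrightarrow> \<psi> (\<phi> x) = x" and \<phi>\<psi>: "\<And>y. y \<in> com_space B \<Longrightarrow> \<phi> (\<psi> y) = y"
    and iso: "\<And>x x'. x \<in> com_space A \<Longrightarrow> x' \<in> com_space A \<Longrightarrow> pairing B (\<phi> x) (\<phi> x') = pairing A x x'"
  shows "is_unitary adj A B \<phi>"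
proof -
  have "adj A B \<phi> = \<psi>"
    using iso[OF _ lin_in[OF \<psi>]] \<phi>\<psi> by (intro adj_eqI[OF \<phi> \<psi> A B]) force
  moreover have "\<psi> \<circ> \<phi> = idm A"
    by (rule lin_eqI[OF lin_comp[OF \<phi> \<psi>] idm_lin[OF A]]) (simp add: \<psi>\<phi>)
  moreover have "\<phi> \<circ> \<psi> = idm B"
    by (rule lin_eqI[OF lin_comp[OF \<psi> \<phi>] idm_lin[OF B]]) (simp add: \<phi>\<psi>)
  ultimately show ?thesis by (simp add: is_unitary_def)
qed

text \<open>At triple products the two pairings are the same product of three real numbers,
  bracketed differently.\<close>

lemma assoc_unitary:
  assumes obj: "A \<in> Obj C" "B \<in> Obj C" "D \<in> Obj C"
  shows "is_unitary adj ((A \<otimes> B) \<otimes> D) (A \<otimes> (B \<otimes> D)) (assoc C A B D)"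
proof (rule isometry_unitary[OF assoc_lin[OF obj] assoc_inv_lin[OF obj]])
  let ?a = "assoc C A B D"
  note a = assoc_lin[OF obj]
  fix x y assume x: "x \<in> com_space ((A \<otimes> B) \<otimes> D)" and y: "y \<in> com_space ((A \<otimes> B) \<otimes> D)"
  from obj x show "pairing (A \<otimes> (B \<otimes> D)) (?a x) (?a y) = pairing ((A \<otimes> B) \<otimes> D) x y"
  proof (induction rule: triple_tensor_induct_left)
    case (tvec \<alpha> \<beta> \<delta>)
    note x = this
    from obj y show ?case
    proof (induction rule: triple_tensor_induct_left)
      case (add u v)
      then show ?case
        using x obj by (simp add: lin_add[OF a] lin_in[OF a] pairing_add_right)
    qed (use x obj in \<open>simp add: mult.assoc\<close>)
  next
    case (add u v)
    then show ?case
      using y obj by (simp add: lin_add[OF a] lin_in[OF a] pairing_add_left)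
  qed
qed (use obj in \<open>simp_all add: assoc_inv_assoc assoc_assoc_inv\<close>)

text \<open>Reduces isometry to product vectors; used for both unit isomorphisms and for the
  symmetry.\<close>

lemma tensor_isometry:
  assumes obj: "A \<in> Obj C" "B \<in> Obj C" "D \<in> Obj C" and \<phi>: "\<phi> \<in> lin (A \<otimes> B) D"
    and iso: "\<And>\<alpha> \<alpha>' \<beta> \<beta>'. \<alpha> \<in> com_space A \<Longrightarrow> \<alpha>' \<in> com_space A \<Longrightarrow> \<beta> \<in> com_space B \<Longrightarrow> \<beta>' \<in> com_space B \<Longrightarrow>
      pairing D (\<phi> (tvec C A B \<alpha> \<beta>)) (\<phi> (tvec C A B \<alpha>' \<beta>')) = pairing A \<alpha> \<alpha>' * pairing B \<beta> \<beta>'"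
    and x: "x \<in> com_space (A \<otimes> B)" and y: "y \<in> com_space (A \<otimes> B)"
  shows "pairing D (\<phi> x) (\<phi> y) = pairing (A \<otimes> B) x y"
  using obj(1,2) x
proof (induction rule: tensor_induct)
  case (tvec \<alpha> \<beta>)
  note x = this
  from obj(1,2) y show ?case
  proof (induction rule: tensor_induct)
    case (add u v)
    then show ?case
      using x obj by (simp add: lin_add[OF \<phi>] lin_in[OF \<phi>] pairing_add_right)
  qed (use x obj iso in simp)
next
  case (add u v)
  then show ?case
    using y obj by (simp add: lin_add[OF \<phi>] lin_in[OF \<phi>] pairing_add_left)
qed

lemma lunit_unitary:
  assumes A: "A \<in> Obj C"
  shows "is_unitary adj (\<I> \<otimes> A) A (lunit C A)"
  by (rule isometry_unitary[OF lunit_lin[OF A] lunit_inv_lin[OF A] _ _ _ _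
      tensor_isometry[OF I_Obj A A lunit_lin[OF A]]])
    (use A in \<open>simp_all add: lunit_inv_lunit pairing_I pairing_scale_left pairing_scale_right\<close>)

lemma runit_unitary:
  assumes A: "A \<in> Obj C"
  shows "is_unitary adj (A \<otimes> \<I>) A (runit C A)"
  by (rule isometry_unitary[OF runit_lin[OF A] runit_inv_lin[OF A] _ _ _ _
      tensor_isometry[OF A I_Obj A runit_lin[OF A]]])
    (use A in \<open>simp_all add: runit_inv_runit pairing_I pairing_scale_left pairing_scale_right\<close>)

lemma swap_unitary:
  assumes A: "A \<in> Obj C" and B: "B \<in> Obj C"
  shows "is_unitary adj (A \<otimes> B) (B \<otimes> A) (swap C A B)"
  by (rule isometry_unitary[OF swap_lin[OF A B] swap_lin[OF B A] _ _ _ _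
      tensor_isometry[OF A B tensor_Obj[OF B A] swap_lin[OF A B]]])
    (use A B in \<open>simp_all add: swap_swap\<close>)

text \<open>At a product vector x \<otimes> y both sides are <\<alpha>, x> <\<beta>, y>.\<close>

lemma pairing_tvec_left:
  assumes A: "A \<in> Obj C" and \<alpha>: "\<alpha> \<in> com_space A" and \<beta>: "\<beta> \<in> com_space A"
    and \<tau>: "\<tau> \<in> com_space (A \<otimes> A)"
  shows "pairing (A \<otimes> A) (tvec C A A \<alpha> \<beta>) \<tau> = pairing A \<beta> (contract A A (flat A \<alpha>) \<tau>)"
  using A A \<tau>
proof (induction rule: tensor_induct)
  case (tvec x y)
  then show ?case
    using A \<alpha> \<beta> by (simp add: flat_com_dual flat_apply pairing_scale_right)
next
  case (add x y)
  then show ?case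
    using A \<alpha> \<beta>
    by (simp add: flat_com_dual pairing_add_right lin_add[OF contract_lin] lin_in[OF contract_lin])
qed

text \<open>Contracting \<gamma> with \<open>flat A \<alpha>\<close> returns \<alpha>, in the right
  argument. Hence \<gamma> represents the transposed pairing, and the pairing itself is represented
  by the swapped \<gamma>, as the symmetry is an isometry.\<close>

lemma pairing_\<gamma>:
  assumes A: "A \<in> Obj C" and "\<alpha> \<in> com_space A" "\<beta> \<in> com_space A"
  shows "pairing (A \<otimes> A) (tvec C A A \<alpha> \<beta>) (\<gamma> A (one_vec C)) = pairing A \<beta> \<alpha>"
  using assms by (simp add: pairing_tvec_left sharp_flat)

lemma pairing_swap_swap:
  assumes A: "A \<in> Obj C" and B: "B \<in> Obj C" and x: "x \<in> com_space (A \<otimes> B)" and y: "y \<in> com_space (A \<otimes> B)"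
  shows "pairing (B \<otimes> A) (swap C A B x) (swap C A B y) = pairing (A \<otimes> B) x y"
  by (rule tensor_isometry[OF A B tensor_Obj[OF B A] swap_lin[OF A B] _ x y]) (use A B in simp)

lemma pairing_swap_\<gamma>:
  assumes A: "A \<in> Obj C" and \<alpha>: "\<alpha> \<in> com_space A" and \<beta>: "\<beta> \<in> com_space A"
  shows "pairing (A \<otimes> A) (tvec C A A \<alpha> \<beta>) (swap C A A (\<gamma> A (one_vec C))) = pairing A \<alpha> \<beta>"
  using pairing_swap_swap[OF A A, of "tvec C A A \<beta> \<alpha>" "\<gamma> A (one_vec C)"] assms
  by (simp add: pairing_\<gamma>)

lemma lin_I_eqI:
  assumes "\<phi> \<in> lin \<I> A" "\<psi> \<in> lin \<I> A" "\<phi> (one_vec C) = \<psi> (one_vec C)"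
  shows "\<phi> = \<psi>"
proof (rule lin_eqI[OF assms(1,2)])
  fix x assume "x \<in> com_space \<I>"
  then have "\<phi> (com_unit \<I> x *\<^sub>R one_vec C) = \<psi> (com_unit \<I> x *\<^sub>R one_vec C)"
    by (simp add: lin_scale[OF assms(1)] lin_scale[OF assms(2)] assms(3))
  with \<open>x \<in> com_space \<I>\<close> show "\<phi> x = \<psi> x"
    by (simp add: com_unit_scale_one)
qed

lemma swap_\<gamma>_lin: "A \<in> Obj C \<Longrightarrow> swap C A A \<circ> \<gamma> A \<in> lin \<I> (A \<otimes> A)"
  by (rule lin_comp[OF \<gamma>_lin swap_lin])

lemma swap_\<gamma>_in: "A \<in> Obj C \<Longrightarrow> swap C A A (\<gamma> A (one_vec C)) \<in> com_space (A \<otimes> A)"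
  by (rule lin_in[OF swap_lin]) simp_all

text \<open>The adjoint equation gives <\<omega>, f'(1)> = <f \<omega>, 1>, which at \<alpha>
  \<otimes> \<beta> is <\<alpha>, \<beta>>. The swapped \<gamma> yields the same value, so
  nondegeneracy concludes, for symmetric and other choices alike.\<close>

lemma adj_f:
  assumes A: "A \<in> Obj C"
  shows "adj (A \<otimes> A) \<I> (f A) = swap C A A \<circ> \<gamma> A"
proof (rule lin_I_eqI)
  let ?g = "adj (A \<otimes> A) \<I> (f A) (one_vec C)" and ?h = "swap C A A (\<gamma> A (one_vec C))"
  show lin: "adj (A \<otimes> A) \<I> (f A) \<in> lin \<I> (A \<otimes> A)" "swap C A A \<circ> \<gamma> A \<in> lin \<I> (A \<otimes> A)"
    using A by (simp_all add: adj_lin swap_\<gamma>_lin)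
  have g: "?g \<in> com_space (A \<otimes> A)" by (rule lin_in[OF lin(1)]) simp
  have "?g = ?h"
  proof (rule pairing_nondegenerate[OF tensor_Obj[OF A A] g swap_\<gamma>_in[OF A]])
    fix \<omega> assume "\<omega> \<in> com_space (A \<otimes> A)"
    with A A show "pairing (A \<otimes> A) \<omega> ?g = pairing (A \<otimes> A) \<omega> ?h"
    proof (induction rule: tensor_induct)
      case (tvec \<alpha> \<beta>)
      then show ?case
        using A by (simp add: pairing_adj pairing_I lin_in[OF f_lin] pairing_swap_\<gamma>)
          (simp add: pairing_def)
    next
      case (add x y)
      then show ?case
        using A g swap_\<gamma>_in[OF A] by (simp add: pairing_add_left)
    qed
  qed
  then show "adj (A \<otimes> A) \<I> (f A) (one_vec C) = (swap C A A \<circ> \<gamma> A) (one_vec C)"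
    by simp
qed

text \<open>Paired with \<alpha> \<otimes> \<beta>, the swapped \<gamma> gives <\<alpha>, \<beta>>
  and \<gamma> gives <\<beta>, \<alpha>>; product vectors span and the pairing is
  nondegenerate.\<close>

lemma swap_\<gamma>_iff_pairing_symmetric:
  assumes A: "A \<in> Obj C"
  shows "swap C A A \<circ> \<gamma> A = \<gamma> A \<longleftrightarrow>
    (\<forall>x\<in>com_space A. \<forall>y\<in>com_space A. pairing A x y = pairing A y x)"
proof
  assume "swap C A A \<circ> \<gamma> A = \<gamma> A"
  then have "swap C A A (\<gamma> A (one_vec C)) = \<gamma> A (one_vec C)"
    by (metis comp_apply)
  then show "\<forall>x\<in>com_space A. \<forall>y\<in>com_space A. pairing A x y = pairing A y x"
    using pairing_\<gamma>[OF A] pairing_swap_\<gamma>[OF A] by simp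
next
  assume sym: "\<forall>x\<in>com_space A. \<forall>y\<in>com_space A. pairing A x y = pairing A y x"
  show "swap C A A \<circ> \<gamma> A = \<gamma> A"
  proof (rule lin_I_eqI)
    show "swap C A A \<circ> \<gamma> A \<in> lin \<I> (A \<otimes> A)" "\<gamma> A \<in> lin \<I> (A \<otimes> A)"
      using A by (simp_all add: swap_\<gamma>_lin)
    have "swap C A A (\<gamma> A (one_vec C)) = \<gamma> A (one_vec C)"
    proof (rule pairing_nondegenerate[OF tensor_Obj[OF A A] swap_\<gamma>_in[OF A] \<gamma>_in[OF A]])
      fix \<omega> assume "\<omega> \<in> com_space (A \<otimes> A)"
      with A A show "pairing (A \<otimes> A) \<omega> (swap C A A (\<gamma> A (one_vec C))) = pairing (A \<otimes> A) \<omega> (\<gamma> A (one_vec C))"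
      proof (induction rule: tensor_induct)
        case (tvec \<alpha> \<beta>)
        then show ?case
          using A sym by (simp add: pairing_\<gamma> pairing_swap_\<gamma>)
      next
        case (add x y)
        then show ?case
          using A swap_\<gamma>_in[OF A] by (simp add: pairing_add_left)
      qed
    qed
    then show "(swap C A A \<circ> \<gamma> A) (one_vec C) = \<gamma> A (one_vec C)" by simp
  qed
qed

text \<open>The first duality equation unfolds to \<open>sharp_flat\<close>. The second has on its
  left the canonical adjoint of the identity, so it is \<open>adj_idm\<close>.\<close>

lemma is_dual_self:
  assumes A: "A \<in> Obj C"
  shows "is_dual C A A (\<gamma> A) (f A)"
proof -
  have left: "lunit C A \<circ> tmap C (A \<otimes> A) \<I> A A (f A) (idm A) \<circ> assoc_inv C A A A \<circ>
      tmap C A A \<I> (A \<otimes> A) (idm A) (\<gamma> A) \<circ> runit_inv C A = idm A"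
  proof -
    define N where "N = lunit C A \<circ> (tmap C (A \<otimes> A) \<I> A A (f A) (idm A) \<circ> assoc_inv C A A A)"
    have N: "N \<in> lin (A \<otimes> (A \<otimes> A)) A"
      unfolding N_def by (rule lin_comp lunit_lin tmap_lin assoc_inv_lin f_lin idm_lin | simp add: A)+
    \<comment> \<open>As in \<open>pairing_adj\<close>, \<gamma> is generalised to any \<omega> so
      that induction applies.\<close>
    have N_tvec: "N (tvec C A (A \<otimes> A) \<alpha> \<omega>) = contract A A (flat A \<alpha>) \<omega>"
      if \<alpha>: "\<alpha> \<in> com_space A" and \<omega>: "\<omega> \<in> com_space (A \<otimes> A)" for \<alpha> \<omega>
      using A A \<omega>
    proof (induction rule: tensor_induct)
      case (tvec x y)
      then show ?case
        using A \<alpha> by (simp add: N_def flat_com_dual flat_apply lin_in[OF f_lin]) (simp add: pairing_def)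
    next
      case (add x y)
      then show ?case
        using A \<alpha> by (simp add: tvec_add_right lin_add[OF N] flat_com_dual lin_add[OF contract_lin])
    qed
    have "N \<circ> (tmap C A A \<I> (A \<otimes> A) (idm A) (\<gamma> A) \<circ> runit_inv C A) = idm A"
    proof (rule lin_eqI)
      show "N \<circ> (tmap C A A \<I> (A \<otimes> A) (idm A) (\<gamma> A) \<circ> runit_inv C A) \<in> lin A A"
        by (rule lin_comp runit_inv_lin tmap_lin \<gamma>_lin idm_lin N | simp add: A)+
      fix x assume "x \<in> com_space A"
      then show "(N \<circ> (tmap C A A \<I> (A \<otimes> A) (idm A) (\<gamma> A) \<circ> runit_inv C A)) x = idm A x"
        using A by (simp add: N_tvec sharp_flat)
    qed (simp add: A)
    then show ?thesis by (simp add: N_def o_assoc)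
  qed
  \<comment> \<open>For the identity morphism the factor 1 \<otimes> (\<phi> \<otimes> 1) of the
    adjoint collapses to this identity, which is absorbed here.\<close>
  have "idm (A \<otimes> (A \<otimes> A)) \<circ> assoc C A A A = assoc C A A A"
    using A by (simp add: fun_eq_iff idm_comp[of _ "(A \<otimes> A) \<otimes> A"])
  then have "adj A A (idm A) = runit C A \<circ> tmap C A A (A \<otimes> A) \<I> (idm A) (f A) \<circ> assoc C A A A \<circ>
      tmap C \<I> (A \<otimes> A) A A (\<gamma> A) (idm A) \<circ> lunit_inv C A"
    using A by (simp add: canonical_adjoint_def tmap_idm comp_assoc)
  with left show ?thesis
    using A by (simp add: is_dual_def \<gamma>_Hom f_Hom adj_idm)
qed

lemma dagger_compact_iff_symmetric:
  "dagger_compact C adj (\<lambda>A. A) \<gamma> f \<longleftrightarrow> (\<forall>A\<in>Obj C. swap C A A \<circ> \<gamma> A = \<gamma> A)"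
proof
  assume "dagger_compact C adj (\<lambda>A. A) \<gamma> f"
  then have invol: "\<forall>A\<in>Obj C. \<forall>B\<in>Obj C. \<forall>\<phi>\<in>Hom C A B. adj B A (adj A B \<phi>) = \<phi>"
    by (simp add: dagger_compact_def dagger_monoidal_def is_dagger_def)
  show "\<forall>A\<in>Obj C. swap C A A \<circ> \<gamma> A = \<gamma> A"
  proof
    fix A assume A: "A \<in> Obj C"
    \<comment> \<open>Take the state s sending 1 to \<alpha>. Involutivity gives <y, \<alpha>> = <y,
      s''(1)> = <s'(y), 1>; the pairing of I is multiplication of reals, hence this is <1, s'(y)> =
      <s(1), y> = <\<alpha>, y>.\<close>
    have pos: "pairing A y \<alpha> = pairing A \<alpha> y" if \<alpha>: "\<alpha> \<in> com_pos A" and y: "y \<in> com_space A" for \<alpha> y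
    proof -
      let ?s = "state_map C \<alpha>"
      have "Hom C \<I> A = state_map C ` com_pos A"
        using category A by (simp add: category_of_coms_def)
      with \<alpha> have s: "?s \<in> Hom C \<I> A" by simp
      then have s': "?s \<in> lin \<I> A" using A by (simp add: Hom_lin)
      have t: "adj \<I> A ?s \<in> lin A \<I>" using s' A by (simp add: adj_lin)
      have one: "?s (one_vec C) = \<alpha>" by (simp add: state_map_def)
      have "adj A \<I> (adj \<I> A ?s) = ?s" using invol A s by simp
      then have "pairing A y \<alpha> = pairing \<I> (adj \<I> A ?s y) (one_vec C)"
        using pairing_adj[OF t A I_Obj y one_vec_in] one by simp
      also have "\<dots> = pairing \<I> (one_vec C) (adj \<I> A ?s y)"
        using lin_in[OF t y] by (simp add: pairing_I)
      also have "\<dots> = pairing A \<alpha> y"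
        using pairing_adj[OF s' I_Obj A one_vec_in y] one by simp
      finally show ?thesis .
    qed
    have "pairing A x y = pairing A y x" if x: "x \<in> com_space A" and y: "y \<in> com_space A" for x y
    proof -
      obtain \<alpha> \<beta> where \<alpha>\<beta>: "\<alpha> \<in> com_pos A" "\<beta> \<in> com_pos A" "x = \<alpha> - \<beta>"
        using com_space_diffE[OF Obj_is_com[OF A] x] .
      then have mem: "\<alpha> \<in> com_space A" "\<beta> \<in> com_space A"
        using com_pos_subset[OF Obj_is_com[OF A]] by auto
      \<comment> \<open>A sum with a scalar multiple, the form in which bilinearity of the pairing
        is available.\<close>
      have x': "x = \<alpha> + (-1) *\<^sub>R \<beta>" using \<alpha>\<beta>(3) by simp
      have m: "(-1) *\<^sub>R \<beta> \<in> com_space A" using A mem by (intro com_space_scale)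
      show ?thesis
        unfolding x' pairing_add_left[OF A mem(1) y m] pairing_add_right[OF A y mem(1) m]
          pairing_scale_left[OF A mem(2) y] pairing_scale_right[OF A y mem(2)]
        using pos[OF \<alpha>\<beta>(1) y] pos[OF \<alpha>\<beta>(2) y] by simp
    qed
    with A show "swap C A A \<circ> \<gamma> A = \<gamma> A"
      by (simp add: swap_\<gamma>_iff_pairing_symmetric)
  qed
next
  assume sym: "\<forall>A\<in>Obj C. swap C A A \<circ> \<gamma> A = \<gamma> A"
  \<comment> \<open>The adjoint equation moves a map from the left argument to the right; with both
    pairings symmetric it also moves back, so \<phi> is the adjoint of its adjoint.\<close>
  have invol: "adj B A (adj A B \<phi>) = \<phi>" if \<phi>: "\<phi> \<in> lin A B" and A: "A \<in> Obj C" and B: "B \<in> Obj C" for A B \<phi>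
  proof (rule adj_eqI[OF adj_lin[OF \<phi> A B] \<phi> B A])
    fix x y assume x: "x \<in> com_space B" and y: "y \<in> com_space A"
    have "pairing B x (\<phi> y) = pairing B (\<phi> y) x"
      using sym B x lin_in[OF \<phi> y] by (simp add: swap_\<gamma>_iff_pairing_symmetric)
    also have "\<dots> = pairing A y (adj A B \<phi> x)"
      by (simp add: pairing_adj[OF \<phi> A B y x])
    also have "\<dots> = pairing A (adj A B \<phi> x) y"
      using sym A y lin_in[OF adj_lin[OF \<phi> A B] x] by (simp add: swap_\<gamma>_iff_pairing_symmetric)
    finally show "pairing B x (\<phi> y) = pairing A (adj A B \<phi> x) y" .
  qed
  \<comment> \<open>By \<open>adj_f\<close> the right-hand side is \<gamma> swapped twice, and each
    swap fixes \<gamma>.\<close>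
  have eta: "\<gamma> A = swap C A A \<circ> adj (A \<otimes> A) \<I> (f A)" if "A \<in> Obj C" for A
    using sym that by (simp add: adj_f)
  have "is_dagger C adj"
    unfolding is_dagger_def
    by (intro conjI ballI adj_Hom adj_idm adj_comp invol Hom_lin) assumption+
  then have "dagger_monoidal C adj"
    unfolding dagger_monoidal_def
    by (intro conjI ballI assoc_unitary lunit_unitary runit_unitary swap_unitary adj_tmap Hom_lin)
  then show "dagger_compact C adj (\<lambda>A. A) \<gamma> f"
    unfolding dagger_compact_def using is_dual_self eta by simp
qed

end

theorem corollary28:
  fixes C :: "'v::real_normed_vector com_category"
  assumes "monoidal_category_of_coms C"
    and "weakly_self_dual C"
    and "compatible_choices_possible C"
  shows "(\<exists>\<gamma> f. self_duality_choice C \<gamma> f \<and>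
            dagger_compact C (canonical_adjoint C \<gamma> f) (\<lambda>A. A) \<gamma> f)
         \<longleftrightarrow> symmetrically_self_dual C"
proof
  assume "\<exists>\<gamma> f. self_duality_choice C \<gamma> f \<and>
    dagger_compact C (canonical_adjoint C \<gamma> f) (\<lambda>A. A) \<gamma> f"
  then obtain \<gamma> f where choice: "self_duality_choice C \<gamma> f"
    and compact: "dagger_compact C (canonical_adjoint C \<gamma> f) (\<lambda>A. A) \<gamma> f"
    by blast
  interpret self_dual_coms C \<gamma> f
    using assms(1) choice by unfold_locales
  have "\<forall>A\<in>Obj C. swap C A A \<circ> \<gamma> A = \<gamma> A"
    using compact dagger_compact_iff_symmetric by simp
  then show "symmetrically_self_dual C"
    unfolding symmetrically_self_dual_def using implements by blast
next
  assume "symmetrically_self_dual C"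
  \<comment> \<open>Symmetric self-duality provides pairs object by object; the standing assumption
    turns them into one symmetric family compatible with tensor products.\<close>
  then obtain \<gamma> f where choice: "self_duality_choice C \<gamma> f"
    and sym: "\<forall>A\<in>Obj C. swap C A A \<circ> \<gamma> A = \<gamma> A"
    using assms(3) unfolding compatible_choices_possible_def by blast
  interpret self_dual_coms C \<gamma> f
    using assms(1) choice by unfold_locales
  show "\<exists>\<gamma> f. self_duality_choice C \<gamma> f \<and>
      dagger_compact C (canonical_adjoint C \<gamma> f) (\<lambda>A. A) \<gamma> f"
    using choice sym dagger_compact_iff_symmetric by blast
qed

end
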